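(* Let $\alpha \ge 2\pi$ be a real number and $a \in (0,1]$. Define \[ C_\alpha(a) \;=\; \lim_{N\to\infty}\left(\sum_{n=1}^{N}\frac{\log^{\alpha}(n+a)}{n+a} \;-\; \frac{\log^{\alpha+1}(N+a)}{\alpha+1}\right), \] equivalently $C_\alpha(a)=\gamma_\alpha(a)-\frac{\log^\alpha a}{a}$, where $\gamma_\alpha(a)$ is the (fractional) Stieltjes constant. Let $w(\alpha)=W_0\!\left(\frac{\alpha i}{2\pi}\right)$, where $W_0$ is the principal branch of the Lambert $W$ function. Then \[ |C_\alpha(a)| \;<\; \alpha^2 + \frac{3}{4}\,\alpha^2\log\alpha\cdot\left|e^{\alpha\left(\log w(\alpha) - 1/w(\alpha)\right)}\right|, \] where $\log$ denotes the principal branch of the logarithm.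
   Context: The Lambert $W$ function is the multivalued inverse of $z\mapsto ze^z$, i.e. $W(z)e^{W(z)}=z$; $W_0$ is its principal branch. The fractional Stieltjes constants $\gamma_\alpha(a)$ (Kreminski) generalize the coefficients in the Laurent expansion $\zeta(s,a)=\frac{1}{s-1}+\sum_{n\ge0}\frac{(-1)^n\gamma_n(a)}{n!}(s-1)^n$ of the Hurwitz zeta function $\zeta(s,a)=\sum_{n\ge 0}(n+a)^{-s}$ to real $\alpha>0$, via $\gamma_\alpha(a)=\lim_{N\to\infty}\left(\sum_{n=0}^{N}\frac{\log^\alpha(n+a)}{n+a}-\frac{\log^{\alpha+1}(N+a)}{\alpha+1}\right)$. *)

theory Defs
  imports "HOL-Analysis.Analysis"
begin

text \<open>
  The range of the principal branch of the Lambert W function, in the convention of Corless, Gonnet,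
  Hare, Jeffrey and Knuth: it is bounded by the curve
  \<open>{-y * cot y + i * y | -pi < y < pi}\<close> (read as the point \<open>-1\<close> for \<open>y = 0\<close>), which is the part of
  the preimage of the branch cut \<open>]-\<infinity>, -1/e]\<close> that lies in the strip \<open>\<bar>Im w\<bar> < pi\<close>.
  The values on the cut are the limits from above, so the half of the curve with \<open>Im w \<ge> 0\<close> belongs
  to the range and the other half does not.
\<close>

definition lambert_W0_range :: "complex set" where
  "lambert_W0_range =
     {w. \<bar>Im w\<bar> < pi \<and>
         (Im w = 0 \<longrightarrow> Re w \<ge> -1) \<and>
         (Im w > 0 \<longrightarrow> Re w \<ge> - Im w * cot (Im w)) \<and>
         (Im w < 0 \<longrightarrow> Re w > - Im w * cot (Im w))}"

definition lambert_W0 :: "complex \<Rightarrow> complex" where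
  "lambert_W0 z = (THE w. w * exp w = z \<and> w \<in> lambert_W0_range)"

text \<open>
  For \<open>a < 1\<close> the term \<open>n = 0\<close> contains a power of the negative number \<open>ln a\<close>, so the fractional
  Stieltjes constants are complex in general; \<open>powr\<close> on complex numbers uses the principal logarithm.
\<close>

definition frac_stieltjes :: "real \<Rightarrow> real \<Rightarrow> complex" where
  "frac_stieltjes \<alpha> a =
     lim (\<lambda>N. (\<Sum>n=0..N. of_real (ln (real n + a)) powr of_real \<alpha> / of_real (real n + a))
              - of_real (ln (real N + a)) powr of_real (\<alpha> + 1) / of_real (\<alpha> + 1))"

definition stieltjes_C :: "real \<Rightarrow> real \<Rightarrow> real" where
  "stieltjes_C \<alpha> a =
     lim (\<lambda>N. (\<Sum>n=1..N. ln (real n + a) powr \<alpha> / (real n + a))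
              - ln (real N + a) powr (\<alpha> + 1) / (\<alpha> + 1))"

lemma convergent_stieltjes_C:
  fixes \<alpha> a :: real
  assumes "\<alpha> > 0" "a > 0"
  shows "convergent (\<lambda>N. (\<Sum>n=1..N. ln (real n + a) powr \<alpha> / (real n + a))
              - ln (real N + a) powr (\<alpha> + 1) / (\<alpha> + 1))"
proof -
  define f where "f = (\<lambda>x::real. ln x powr \<alpha> / x)"
  define F where "F = (\<lambda>x::real. ln x powr (\<alpha> + 1) / (\<alpha> + 1))"
  define D where "D = (\<lambda>N. (\<Sum>n=1..N. f (real n + a)) - F (real N + a))"
  obtain M :: nat where M: "real M > exp \<alpha>"
    using reals_Archimedean2 by blast
  have gt1: "x > 1" and lnge: "ln x \<ge> \<alpha>" if "x \<ge> real M" for x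
  proof -
    have "x \<ge> exp \<alpha>" using that M by simp
    moreover have "exp \<alpha> > 1" using assms by simp
    ultimately show "x > 1" by (rule less_le_trans[rotated])
    then show "ln x \<ge> \<alpha>" using \<open>x \<ge> exp \<alpha>\<close> by (simp add: ln_ge_iff)
  qed
  have dF: "(F has_real_derivative f x) (at x)" if "x \<ge> real M" for x
    unfolding F_def f_def using gt1[OF that] assms
    by (auto intro!: derivative_eq_intros simp: divide_simps)
  have df: "(f has_real_derivative (\<alpha> * ln x powr (\<alpha> - 1) - ln x powr \<alpha>) / x\<^sup>2) (at x)"
    if "x \<ge> real M" for x
    unfolding f_def using gt1[OF that] assms
    by (auto intro!: derivative_eq_intros simp: field_simps power2_eq_square)
  have mono: "f y \<le> f x" if "x \<ge> real M" "x \<le> y" for x y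
  proof (rule DERIV_nonpos_imp_nonincreasing[OF that(2)])
    fix t assume t: "x \<le> t" "t \<le> y"
    have tM: "t \<ge> real M" using t that by simp
    have "\<alpha> * ln t powr (\<alpha> - 1) \<le> ln t * ln t powr (\<alpha> - 1)"
      using lnge[OF tM] by (intro mult_right_mono) auto
    also have "\<dots> = ln t powr \<alpha>"
      using gt1[OF tM] by (simp add: powr_mult_base)
    finally show "\<exists>z. (f has_real_derivative z) (at t) \<and> z \<le> 0"
      using df[OF tM] by (intro exI conjI) (auto intro!: divide_nonpos_nonneg)
  qed
  have step: "D (Suc N) \<le> D N" "D N - f (real N + a) \<le> D (Suc N) - f (real (Suc N) + a)"
    if "N \<ge> M" for N
  proof -
    have NM: "real N + a \<ge> real M" using that assms by linarith
    obtain z where z: "real N + a < z" "z < real N + a + 1"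
      "F (real N + a + 1) - F (real N + a) = (real N + a + 1 - (real N + a)) * f z"
      using MVT2[of "real N + a" "real N + a + 1" F f] dF NM by force
    have eq: "D (Suc N) = D N + f (real (Suc N) + a) - f z"
      using z(3) by (simp add: D_def algebra_simps)
    have "f (real (Suc N) + a) \<le> f z" by (rule mono) (use z NM in auto)
    then show "D (Suc N) \<le> D N" using eq by simp
    have "f z \<le> f (real N + a)" by (rule mono) (use z NM in auto)
    then show "D N - f (real N + a) \<le> D (Suc N) - f (real (Suc N) + a)" using eq by simp
  qed
  have lower: "D M - f (real M + a) \<le> D (N + M) - f (real (N + M) + a)" for N
  proof (induction N)
    case (Suc N)
    then show ?case using step(2)[of "N + M"] by simp
  qed simp
  have fnn: "f (real (N + M) + a) \<ge> 0" for N
    unfolding f_def using assms by simp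
  have "decseq (\<lambda>N. D (N + M))"
    by (rule decseq_SucI) (use step(1) in simp)
  moreover have "D M - f (real M + a) \<le> D (N + M)" for N
    using lower[of N] fnn[of N] by linarith
  ultimately obtain L where "(\<lambda>N. D (N + M)) \<longlonglongrightarrow> L"
    using decseq_convergent[of "\<lambda>N. D (N + M)"] by metis
  then have "D \<longlonglongrightarrow> L" by (rule LIMSEQ_offset)
  then show ?thesis
    unfolding D_def f_def F_def convergent_def by blast
qed

lemma stieltjes_C_eq_frac_stieltjes:
  fixes \<alpha> a :: real
  assumes "\<alpha> > 0" "a > 0"
  shows "of_real (stieltjes_C \<alpha> a) =
           frac_stieltjes \<alpha> a - of_real (ln a) powr of_real \<alpha> / of_real a"
proof -
  define R where "R = (\<lambda>N. (\<Sum>n=1..N. ln (real n + a) powr \<alpha> / (real n + a))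
              - ln (real N + a) powr (\<alpha> + 1) / (\<alpha> + 1))"
  define Z where
    "Z = (\<lambda>N. (\<Sum>n=0..N. of_real (ln (real n + a)) powr of_real \<alpha> / of_real (real n + a))
              - of_real (ln (real N + a)) powr of_real (\<alpha> + 1) / complex_of_real (\<alpha> + 1))"
  define c where "c = of_real (ln a) powr of_real \<alpha> / complex_of_real a"
  have pos: "ln (real n + a) \<ge> 0" if "n \<ge> 1" for n
    using that assms by (intro ln_ge_zero) linarith
  have real_pow: "complex_of_real (ln (real n + a)) powr of_real s
      = of_real (ln (real n + a) powr s)" if "n \<ge> 1" for n s
    using pos[OF that] by (rule powr_of_real)
  have eq: "Z N = of_real (R N) + c" if "N \<ge> 1" for N
  proof -
    have "(\<Sum>n=0..N. of_real (ln (real n + a)) powr of_real \<alpha> / complex_of_real (real n + a))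
        = c + (\<Sum>n=1..N. of_real (ln (real n + a)) powr of_real \<alpha> / complex_of_real (real n + a))"
      by (simp add: sum.atLeast_Suc_atMost[of 0 N] c_def del: of_real_add)
    also have "(\<Sum>n=1..N. of_real (ln (real n + a)) powr of_real \<alpha> / complex_of_real (real n + a))
        = (\<Sum>n=1..N. of_real (ln (real n + a) powr \<alpha> / (real n + a)))"
      by (intro sum.cong) (simp_all add: real_pow del: of_real_add)
    finally show ?thesis
      unfolding Z_def R_def using real_pow[OF that]
      by (simp del: of_real_add)
  qed
  have "R \<longlonglongrightarrow> stieltjes_C \<alpha> a"
    using convergent_stieltjes_C[OF assms]
    unfolding stieltjes_C_def R_def by (simp add: convergent_LIMSEQ_iff)
  then have "(\<lambda>N. of_real (R N) + c) \<longlonglongrightarrow> of_real (stieltjes_C \<alpha> a) + c"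
    by (intro tendsto_intros)
  then have "Z \<longlonglongrightarrow> of_real (stieltjes_C \<alpha> a) + c"
    by (rule Lim_transform_eventually) (use eq in \<open>auto simp: eventually_sequentially intro!: exI[of _ 1]\<close>)
  then have "frac_stieltjes \<alpha> a = of_real (stieltjes_C \<alpha> a) + c"
    unfolding frac_stieltjes_def Z_def by (rule limI)
  then show ?thesis by (simp add: c_def)
qed

end

theory Submission
  imports Defs "HOL-Complex_Analysis.Complex_Analysis" "HOL-Real_Asymp.Real_Asymp"
begin

text \<open>
  Substitute \<open>z = exp u\<close> and integrate \<open>u powr \<alpha> / (q u - 1)\<close> with \<open>q u = exp (2 pi i (exp u - a))\<close>
  around the rectangle with vertices \<open>\<epsilon> \<plusminus> i\<theta>\<close> and \<open>T \<plusminus> i\<theta>\<close>, where \<open>exp T = N + a + 1/2\<close>. The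
  residues add up to the sum defining the constant, and removing the main term \<open>\<integral> u powr \<alpha>\<close> in the
  upper half leaves an integrand of size \<open>\<bar>u\<bar> powr \<alpha> * exp (-2 pi exp (Re u) \<bar>sin (Im u)\<bar>)\<close>. Let \<open>\<epsilon> \<rightarrow> 0\<close>
  and \<open>N \<rightarrow> \<infinity>\<close>. With \<open>\<theta> = Im w\<close> the upper edge passes through the saddle point \<open>w\<close>, at which this
  size equals \<open>\<bar>exp (\<alpha> (log w - 1/w))\<bar>\<close>. If \<open>\<theta> \<ge> pi/4\<close> the size on the path never exceeds
  the larger of \<open>1\<close> and this value, and the polynomial factors in the claim absorb the length of the
  path. If \<open>\<theta> \<le> pi/4\<close> then \<open>\<alpha> \<le> 19\<close>, and the path with upper edge \<open>Im u = 1\<close> gives a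
  constant bound, which is smaller than \<open>\<alpha>\<^sup>2\<close>.
\<close>

subsection \<open>Residues of the summation kernel\<close>

lemma contour_integral_linepath_Complex_horizontal:
  assumes "a < b"
  shows "contour_integral (linepath (Complex a d) (Complex b d)) f =
         integral {a..b} (\<lambda>x. f (Complex x d))"
proof -
  \<comment> \<open>\<open>F\<close> carries the integrand over to the imaginary axis, where the
    formula for segments of constant real part applies; the factor \<open>- \<i>\<close> undoes the
    rotation of the direction.\<close>
  define F where "F = (\<lambda>u. f (Complex (Im u) d))"
  have *: "linepath (Complex a d) (Complex b d) x = Complex (Im (linepath (Complex 0 a) (Complex 0 b) x)) d"
    for x
    by (simp add: linepath_def complex_eq_iff algebra_simps)
  have "contour_integral (linepath (Complex a d) (Complex b d)) f =
        of_real (b - a) * integral {0..1} (\<lambda>x. f (linepath (Complex a d) (Complex b d) x))"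
    by (simp add: contour_integral_integral Complex_eq)
  also have "\<dots> = - \<i> * ((Complex 0 b - Complex 0 a) *
                    integral {0..1} (\<lambda>x. F (linepath (Complex 0 a) (Complex 0 b) x)))"
    unfolding F_def * by (simp add: Complex_eq algebra_simps)
  also have "\<dots> = - \<i> * contour_integral (linepath (Complex 0 a) (Complex 0 b)) F"
    by (simp add: contour_integral_integral)
  also have "\<dots> = integral {a..b} (\<lambda>x. F (Complex 0 x))"
    by (subst contour_integral_linepath_same_Re[OF _ _ _ _ assms]) auto
  finally show ?thesis by (simp add: F_def)
qed

lemma contour_integral_linepath_Complex_vertical:
  assumes "a < b"
  shows "contour_integral (linepath (Complex c a) (Complex c b)) f =
         \<i> * integral {a..b} (\<lambda>x. f (Complex c x))"
  by (rule contour_integral_linepath_same_Re) (use assms in auto)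

lemma contour_integral_rectpath_Complex:
  assumes "a < b" "c < d" "continuous_on (path_image (rectpath (Complex a c) (Complex b d))) f"
  shows "contour_integral (rectpath (Complex a c) (Complex b d)) f =
      integral {a..b} (\<lambda>t. f (Complex t c)) + \<i> * integral {c..d} (\<lambda>t. f (Complex b t))
    - integral {a..b} (\<lambda>t. f (Complex t d)) - \<i> * integral {c..d} (\<lambda>t. f (Complex a t))"
proof -
  have seg: "path_image (rectpath (Complex a c) (Complex b d)) =
     closed_segment (Complex a c) (Complex b c) \<union> closed_segment (Complex b c) (Complex b d) \<union>
     closed_segment (Complex b d) (Complex a d) \<union> closed_segment (Complex a d) (Complex a c)"
    by (simp add: rectpath_def Let_def path_image_join Un_assoc)
  have int: "f contour_integrable_on linepath (Complex a c) (Complex b c)"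
            "f contour_integrable_on linepath (Complex b c) (Complex b d)"
            "f contour_integrable_on linepath (Complex b d) (Complex a d)"
            "f contour_integrable_on linepath (Complex a d) (Complex a c)"
    by (intro contour_integrable_continuous_linepath continuous_on_subset[OF assms(3)]; auto simp: seg)+
  have rev1: "contour_integral (linepath (Complex b d) (Complex a d)) f =
        - contour_integral (linepath (Complex a d) (Complex b d)) f"
    by (intro contour_integral_reverse_linepath continuous_on_subset[OF assms(3)])
       (auto simp: seg closed_segment_commute)
  have rev2: "contour_integral (linepath (Complex a d) (Complex a c)) f =
        - contour_integral (linepath (Complex a c) (Complex a d)) f"
    by (intro contour_integral_reverse_linepath continuous_on_subset[OF assms(3)])
       (auto simp: seg closed_segment_commute)
  have "contour_integral (rectpath (Complex a c) (Complex b d)) f =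
      contour_integral (linepath (Complex a c) (Complex b c)) f +
      contour_integral (linepath (Complex b c) (Complex b d)) f +
      contour_integral (linepath (Complex b d) (Complex a d)) f +
      contour_integral (linepath (Complex a d) (Complex a c)) f"
    using int by (simp add: rectpath_def Let_def contour_integrable_joinI)
  also have "\<dots> = integral {a..b} (\<lambda>t. f (Complex t c)) + \<i> * integral {c..d} (\<lambda>t. f (Complex b t))
    - integral {a..b} (\<lambda>t. f (Complex t d)) - \<i> * integral {c..d} (\<lambda>t. f (Complex a t))"
    using assms(1,2)
    by (simp add: rev1 rev2 contour_integral_linepath_Complex_horizontal
                  contour_integral_linepath_Complex_vertical)
  finally show ?thesis .
qed

text \<open>The function \<open>q\<close> of the outline. In the variable \<open>z = exp u\<close>
  it is \<open>exp (2 pi i (z - a))\<close>, so that \<open>1 / (expq a u - 1)\<close> is the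
  Abel-Plana summation kernel for the shifted integers \<open>n + a\<close>.\<close>

definition expq :: "real \<Rightarrow> complex \<Rightarrow> complex" where
  "expq a u = exp (2 * of_real pi * \<i> * (exp u - of_real a))"

lemma expq_eq_1_iff: "expq a u = 1 \<longleftrightarrow> (\<exists>n::int. exp u = of_int n + of_real a)"
proof -
  have "expq a u = 1 \<longleftrightarrow> (\<exists>n::int. exp u - of_real a = of_int n)"
    unfolding expq_def exp_eq_1 by (auto simp: complex_eq_iff)
  then show ?thesis by (auto simp: algebra_simps)
qed

lemma norm_expq: "norm (expq a u) = exp (- 2 * pi * exp (Re u) * sin (Im u))"
  by (simp add: expq_def Im_exp)

text \<open>Conjugation inverts \<open>q\<close> because \<open>exp u\<close> and \<open>a\<close>
  are conjugated to \<open>exp (cnj u)\<close> and \<open>a\<close>, while \<open>\<i>\<close>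
  changes sign. This is what allows the lower half of the contour to be folded onto the upper
  half.\<close>

lemma expq_cnj: "cnj (expq a u) = 1 / expq a (cnj u)"
  by (simp add: expq_def exp_cnj exp_minus[symmetric] inverse_eq_divide[symmetric] algebra_simps)

lemma holomorphic_expq [holomorphic_intros]: "f holomorphic_on A \<Longrightarrow> (\<lambda>u. expq a (f u)) holomorphic_on A"
  unfolding expq_def by (intro holomorphic_intros)

lemma continuous_expq [continuous_intros]: "continuous_on A f \<Longrightarrow> continuous_on A (\<lambda>u. expq a (f u))"
  unfolding expq_def by (intro continuous_intros)

lemma expq_has_field_derivative:
  "(expq a has_field_derivative expq a u * (2 * of_real pi * \<i> * exp u)) (at u)"
  unfolding expq_def by (auto intro!: derivative_eq_intros)

text \<open>A zero of \<open>expq a u - 1\<close> makes \<open>exp u\<close> real, and in a strip of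
  half-width below \<open>pi / 2\<close> this forces \<open>Im u = 0\<close>. Then
  \<open>Re u > 0\<close> together with \<open>a \<le> 1\<close> rules out indices below 1, and the
  bound on \<open>exp (Re u)\<close> rules out those above \<open>N\<close>.\<close>

lemma expq_eq_1_strip:
  assumes "0 < Re u" "\<bar>Im u\<bar> < pi / 2" "0 \<le> a" "expq a u = 1" "exp (Re u) < real N + 1 + a" "a \<le> 1"
  shows "\<exists>n\<in>{1..N}. u = of_real (ln (real n + a))"
proof -
  from assms(4) obtain n :: int where n: "exp u = of_int n + of_real a"
    unfolding expq_eq_1_iff by auto
  have "exp (Re u) * sin (Im u) = 0"
    using arg_cong[OF n, of Im] by (simp add: Im_exp)
  then have "sin (Im u) = 0" by simp
  then have im: "Im u = 0"
    using assms(2) sin_zero_pi_iff pi_gt_zero by (smt (verit, ccfv_threshold) field_sum_of_halves)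
  have e: "exp (Re u) = of_int n + a"
    using arg_cong[OF n, of Re] im by (simp add: Re_exp)
  then have "of_int n + a > 1" using assms(1) by (metis one_less_exp_iff)
  then have n1: "n \<ge> 1" using assms by linarith
  have n2: "n \<le> int N" using e assms by linarith
  have "Re u = ln (of_int n + a)" using e by (metis ln_exp)
  then have "u = of_real (ln (real (nat n) + a))" using im n1 by (simp add: complex_eq_iff)
  then show ?thesis using n1 n2 by (intro bexI[of _ "nat n"]) auto
qed

text \<open>The poles are simple: at such a point \<open>q = 1\<close>, so the derivative of
  \<open>q\<close> is \<open>2 pi i exp u = 2 pi i (n + a)\<close>, which supplies the denominator
  of the summand.\<close>

lemma residue_expq:
  assumes "a > 0" "n \<ge> 1"
  shows "residue (\<lambda>u. u powr of_real \<alpha> / (expq a u - 1)) (of_real (ln (real n + a))) =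
         of_real (ln (real n + a) powr \<alpha> / (real n + a)) / (2 * of_real pi * \<i>)"
proof -
  define p where "p = complex_of_real (ln (real n + a))"
  have pos: "ln (real n + a) > 0" using assms by simp
  have ep: "exp p = of_nat n + of_real a"
    using assms unfolding p_def exp_of_real by simp
  have q1: "expq a p = 1"
    unfolding expq_eq_1_iff using ep by (intro exI[of _ "int n"]) simp
  have nz: "of_nat n + complex_of_real a \<noteq> 0"
    using assms by (simp add: complex_eq_iff)
  have "residue (\<lambda>u. u powr of_real \<alpha> / (expq a u - 1)) p = p powr of_real \<alpha> / (2 * of_real pi * \<i> * exp p)"
  proof (rule residue_simple_pole_deriv)
    show "(\<lambda>u. u powr of_real \<alpha>) holomorphic_on {u. Re u > 0}"
      by (intro holomorphic_intros) (auto simp: complex_nonpos_Reals_iff)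
    show "(\<lambda>u. expq a u - 1) holomorphic_on {u. Re u > 0}"
      by (intro holomorphic_intros)
    show "open {u. Re u > 0}" by (rule open_halfspace_Re_gt)
    show "connected {u. Re u > 0}" by (intro convex_connected convex_halfspace_Re_gt)
    show "p \<in> {u. Re u > 0}" using pos by (simp add: p_def)
    show "((\<lambda>u. expq a u - 1) has_field_derivative 2 * of_real pi * \<i> * exp p) (at p)"
      using DERIV_diff[OF expq_has_field_derivative[of a p] DERIV_const[of 1]] by (simp add: q1)
    show "p powr of_real \<alpha> \<noteq> 0" using pos by (simp add: p_def)
  qed (use q1 in auto)
  also have "\<dots> = of_real (ln (real n + a) powr \<alpha> / (real n + a)) / (2 * of_real pi * \<i>)"
    using pos nz unfolding ep by (simp add: p_def powr_of_real)
  finally show ?thesis by (simp add: p_def)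
qed

text \<open>The left edge lies before the first pole \<open>ln (1 + a)\<close>, and the right edge,
  with \<open>exp T = N + a + 1/2\<close>, passes between the poles of index \<open>N\<close> and
  \<open>N + 1\<close>. Hence exactly the poles of index 1 to \<open>N\<close> are enclosed.\<close>

lemma contour_integral_expq:
  assumes a: "0 < a" "a \<le> 1" and e: "0 < e" "e < ln (1 + a)" and N: "N \<ge> 1"
    and T: "T = ln (real N + a + 1 / 2)" and h: "0 < h" "h < pi / 2"
  shows "contour_integral (rectpath (Complex e (- h)) (Complex T h))
           (\<lambda>u. u powr of_real \<alpha> / (expq a u - 1)) =
         of_real (\<Sum>n=1..N. ln (real n + a) powr \<alpha> / (real n + a))"
   and "continuous_on (path_image (rectpath (Complex e (- h)) (Complex T h)))
           (\<lambda>u. u powr of_real \<alpha> / (expq a u - 1))"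
   and "e < T"
proof -
  define f where "f = (\<lambda>u. u powr of_real \<alpha> / (expq a u - 1))"
  \<comment> \<open>An open convex neighbourhood of the closed rectangle that still avoids the pole
    of index \<open>N + 1\<close> and the branch cut of \<open>powr\<close>.\<close>
  define S where "S = {u. Re u > 0} \<inter> {u. Re u < ln (real N + 1 + a)} \<inter> ({u. Im u < pi / 2} \<inter> {u. Im u > - (pi / 2)})"
  define p where "p = (\<lambda>n. complex_of_real (ln (real n + a)))"
  define g where "g = rectpath (Complex e (- h)) (Complex T h)"
  have lt: "ln (real n + a) < T" "ln (real n + a) > e" if "n \<in> {1..N}" for n
  proof -
    show "ln (real n + a) < T" using that a unfolding T by simp
    have "ln (1 + a) \<le> ln (real n + a)" using that a by simp
    then show "ln (real n + a) > e" using e by simp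
  qed
  have eT: "e < T" using lt[of N] N by simp
  have T2: "T < ln (real N + 1 + a)" using a unfolding T by simp
  have "open S" unfolding S_def
    by (intro open_Int open_halfspace_Re_gt open_halfspace_Re_lt open_halfspace_Im_gt open_halfspace_Im_lt)
  have "convex S" unfolding S_def
    by (intro convex_Int convex_halfspace_Re_gt convex_halfspace_Re_lt convex_halfspace_Im_gt convex_halfspace_Im_lt)
  have inj: "inj_on p {1..N}"
    unfolding p_def using a by (auto simp: inj_on_def)
  have img: "path_image g \<subseteq> S - p ` {1..N}"
  proof
    fix u assume u: "u \<in> path_image g"
    then have u1: "u \<in> cbox (Complex e (- h)) (Complex T h)" "u \<notin> box (Complex e (- h)) (Complex T h)"
      unfolding g_def using eT h by (auto simp: path_image_rectpath_cbox_minus_box)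
    have "u \<in> S" using u1(1) e T2 h by (auto simp: S_def in_cbox_complex_iff)
    moreover have "p n \<in> box (Complex e (- h)) (Complex T h)" if "n \<in> {1..N}" for n
      using lt[OF that] h by (auto simp: p_def in_box_complex_iff)
    ultimately show "u \<in> S - p ` {1..N}" using u1(2) by auto
  qed
  have ne: "expq a u \<noteq> 1" if "u \<in> S - p ` {1..N}" for u
  proof
    assume "expq a u = 1"
    moreover have "exp (Re u) < real N + 1 + a"
    proof -
      have "exp (Re u) < exp (ln (real N + 1 + a))" using that by (auto simp: S_def)
      then show ?thesis using a by simp
    qed
    moreover have "\<bar>Im u\<bar> < pi / 2" "0 < Re u" using that by (auto simp: S_def)
    ultimately have "\<exists>n\<in>{1..N}. u = of_real (ln (real n + a))"
      using a by (intro expq_eq_1_strip) auto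
    then show False using that by (auto simp: p_def)
  qed
  have hol: "f holomorphic_on S - p ` {1..N}"
    unfolding f_def
    by (intro holomorphic_intros) (use ne in \<open>auto simp: complex_nonpos_Reals_iff S_def\<close>)
  have w1: "winding_number g (p n) = 1" if "n \<in> {1..N}" for n
    unfolding g_def using lt[OF that] h
    by (intro winding_number_rectpath) (auto simp: p_def in_box_complex_iff)
  have "contour_integral g f = 2 * pi * \<i> * (\<Sum>x\<in>p ` {1..N}. winding_number g x * residue f x)"
  proof (rule Residue_theorem[OF \<open>open S\<close> _ _ hol])
    show "connected S" using \<open>convex S\<close> by (rule convex_connected)
    show "\<forall>z. z \<notin> S \<longrightarrow> winding_number g z = 0"
      using img \<open>convex S\<close> by (auto intro!: winding_number_zero_outside[of _ S] simp: g_def)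
  qed (use img in \<open>auto simp: g_def\<close>)
  also have "\<dots> = 2 * pi * \<i> * (\<Sum>n\<in>{1..N}. residue f (p n))"
    unfolding sum.reindex[OF inj] o_def by (intro arg_cong2[of _ _ _ _ "(*)"] sum.cong refl) (simp add: w1)
  also have "\<dots> = (\<Sum>n\<in>{1..N}. 2 * pi * \<i> * (of_real (ln (real n + a) powr \<alpha> / (real n + a)) / (2 * of_real pi * \<i>)))"
    unfolding sum_distrib_left f_def p_def using a
    by (intro sum.cong refl arg_cong2[of _ _ _ _ "(*)"] residue_expq) auto
  also have "\<dots> = of_real (\<Sum>n=1..N. ln (real n + a) powr \<alpha> / (real n + a))"
    unfolding of_real_sum by (intro sum.cong refl, subst times_divide_eq_right) (simp del: of_real_divide)
  finally show "contour_integral (rectpath (Complex e (- h)) (Complex T h))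
           (\<lambda>u. u powr of_real \<alpha> / (expq a u - 1)) =
         of_real (\<Sum>n=1..N. ln (real n + a) powr \<alpha> / (real n + a))"
    by (simp add: g_def f_def)
  show "continuous_on (path_image (rectpath (Complex e (- h)) (Complex T h)))
           (\<lambda>u. u powr of_real \<alpha> / (expq a u - 1))"
    using continuous_on_subset[OF holomorphic_on_imp_continuous_on[OF hol] img]
    by (simp add: g_def f_def)
  show "e < T" by (rule eT)
qed

text \<open>In the upper half-plane \<open>1 / (q - 1) = q / (q - 1) - 1\<close>; this is the part that decays there.\<close>
definition plana_kernel :: "real \<Rightarrow> real \<Rightarrow> complex \<Rightarrow> complex" where
  "plana_kernel \<alpha> a u = u powr of_real \<alpha> * (expq a u / (expq a u - 1))"

section \<open>Folding the rectangle onto the upper half-plane\<close>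

lemma plana_kernel_cnj:
  assumes "Re u > 0"
  shows "cnj u powr of_real \<alpha> / (expq a (cnj u) - 1) = - cnj (plana_kernel \<alpha> a u)"
proof -
  define c where "c = cnj (expq a u)"
  have c0: "c \<noteq> 0" by (simp add: c_def expq_def)
  have q: "expq a (cnj u) = 1 / c"
    using expq_cnj[of a "cnj u"] by (simp add: c_def) (metis complex_cnj_cnj complex_cnj_divide complex_cnj_one)
  \<comment> \<open>For \<open>c = 1\<close> both sides are 0, since division by 0 yields 0.\<close>
  have "1 / (1 / c - 1) = - (c / (c - 1))"
    using c0 by (cases "c = 1") (auto simp: field_simps)
  then have "cnj u powr of_real \<alpha> / (1 / c - 1) = - (cnj u powr of_real \<alpha> * (c / (c - 1)))"
    by (simp add: divide_inverse)
  then show ?thesis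
    using assms by (simp add: q plana_kernel_def cnj_powr c_def)
qed

lemma plana_kernel_eq:
  assumes "expq a u \<noteq> 1"
  shows "u powr of_real \<alpha> / (expq a u - 1) = plana_kernel \<alpha> a u - u powr of_real \<alpha>"
  using assms by (simp add: plana_kernel_def field_simps)

lemma contour_integral_powr_linepath:
  assumes "Re x > 0" "Re y > 0" "\<alpha> > 0"
  shows "contour_integral (linepath x y) (\<lambda>u. u powr of_real \<alpha>) =
         y powr of_real (\<alpha> + 1) / of_real (\<alpha> + 1) - x powr of_real (\<alpha> + 1) / of_real (\<alpha> + 1)"
proof -
  have nz: "of_real \<alpha> + (1::complex) \<noteq> 0" using assms
    by (metis add_pos_pos less_irrefl of_real_1 of_real_add of_real_eq_0_iff zero_less_one)
  have "((\<lambda>u. u powr of_real \<alpha>) has_contour_integral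
     (pathfinish (linepath x y)) powr of_real (\<alpha> + 1) / of_real (\<alpha> + 1) -
     (pathstart (linepath x y)) powr of_real (\<alpha> + 1) / of_real (\<alpha> + 1)) (linepath x y)"
  proof (rule contour_integral_primitive[where S = "{u. Re u > 0}"])
    fix u :: complex assume "u \<in> {u. Re u > 0}"
    then have u: "u \<notin> \<real>\<^sub>\<le>\<^sub>0" by (auto simp: complex_nonpos_Reals_iff)
    show "((\<lambda>u. u powr of_real (\<alpha> + 1) / of_real (\<alpha> + 1)) has_field_derivative u powr of_real \<alpha>)
        (at u within {u. Re u > 0})"
      using DERIV_cdivide[OF has_field_derivative_at_within[OF has_field_derivative_powr[OF u, of "of_real (\<alpha> + 1)"]],
        where c = "of_real (\<alpha> + 1)"] nz by simp
  next
    show "path_image (linepath x y) \<subseteq> {u. Re u > 0}"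
      using assms closed_segment_subset[OF _ _ convex_halfspace_Re_gt[of 0], of x y] by auto
  qed auto
  then show ?thesis by (simp add: contour_integral_unique)
qed

lemma continuous_on_Complex_right: "continuous_on A (\<lambda>t. Complex c t)"
  and continuous_on_Complex_left: "continuous_on A (\<lambda>t. Complex t c)"
  unfolding Complex_eq by (intro continuous_intros)+

text \<open>With \<open>V\<close> the kernel integral over the upper half of the edge, the lower
  half contributes \<open>- cnj V\<close> and the upper half contributes \<open>V\<close> minus the
  main term. The sum \<open>V - cnj V\<close> is \<open>2 \<i> Im V\<close>, and the main term
  survives on the upper half only.\<close>

lemma integral_vertical_plana_kernel:
  assumes b: "b > 0" and h: "h > 0"
    and c: "continuous_on (Complex b ` {-h..h}) (\<lambda>u. u powr of_real \<alpha> / (expq a u - 1))"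
    and ne: "\<And>t. t \<in> {0..h} \<Longrightarrow> expq a (Complex b t) \<noteq> 1"
  shows "integral {-h..h} (\<lambda>t. Complex b t powr of_real \<alpha> / (expq a (Complex b t) - 1)) =
    2 * \<i> * of_real (Im (integral {0..h} (\<lambda>t. plana_kernel \<alpha> a (Complex b t))))
    - integral {0..h} (\<lambda>t. Complex b t powr of_real \<alpha>)"
proof -
  let ?G = "\<lambda>u. u powr of_real \<alpha> / (expq a u - 1)"
  let ?V = "integral {0..h} (\<lambda>t. plana_kernel \<alpha> a (Complex b t))"
  have cG: "continuous_on {-h..h} (\<lambda>t. ?G (Complex b t))"
    by (rule continuous_on_compose2[OF c continuous_on_Complex_right]) auto
  have cp: "continuous_on {0..h} (\<lambda>t. Complex b t powr of_real \<alpha>)"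
    by (intro continuous_on_powr_complex continuous_on_Complex_right continuous_intros)
       (use b in \<open>auto simp: complex_nonpos_Reals_iff complex_eq_iff\<close>)
  have "integral {-h..h} (\<lambda>t. ?G (Complex b t)) =
     integral {-h..0} (\<lambda>t. ?G (Complex b t)) + integral {0..h} (\<lambda>t. ?G (Complex b t))"
    by (rule Henstock_Kurzweil_Integration.integral_combine[symmetric]) (use h in \<open>auto intro!: integrable_continuous_real cG\<close>)
  also have "integral {-h..0} (\<lambda>t. ?G (Complex b t)) = integral {0..h} (\<lambda>t. ?G (Complex b (-t)))"
    using Henstock_Kurzweil_Integration.integral_reflect_real[of h 0 "\<lambda>t. ?G (Complex b (-t))"] by simp
  also have "\<dots> = integral {0..h} (\<lambda>t. - cnj (plana_kernel \<alpha> a (Complex b t)))"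
  proof (rule integral_cong)
    fix t
    have "Complex b (-t) = cnj (Complex b t)" by (simp add: complex_eq_iff)
    then show "?G (Complex b (-t)) = - cnj (plana_kernel \<alpha> a (Complex b t))"
      using plana_kernel_cnj[of "Complex b t"] b by simp
  qed
  also have "\<dots> = - cnj ?V"
    by (simp add: integral_cnj)
  also have "integral {0..h} (\<lambda>t. ?G (Complex b t)) =
     integral {0..h} (\<lambda>t. plana_kernel \<alpha> a (Complex b t) - Complex b t powr of_real \<alpha>)"
    by (intro integral_cong plana_kernel_eq ne) auto
  also have "\<dots> = ?V - integral {0..h} (\<lambda>t. Complex b t powr of_real \<alpha>)"
  proof (rule integral_diff)
    have "(\<lambda>t. ?G (Complex b t) + Complex b t powr of_real \<alpha>) integrable_on {0..h}"
      using h by (intro integrable_continuous_real continuous_on_add cp continuous_on_subset[OF cG]) auto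
    then show "(\<lambda>t. plana_kernel \<alpha> a (Complex b t)) integrable_on {0..h}"
      by (rule integrable_eq) (use ne in \<open>simp add: plana_kernel_eq\<close>)
    show "(\<lambda>t. Complex b t powr of_real \<alpha>) integrable_on {0..h}"
      by (intro integrable_continuous_real cp)
  qed
  finally show ?thesis
    by (simp add: complex_eq_iff)
qed

lemma expq_ne_1_upper:
  assumes "0 < Im u" "Im u < pi"
  shows "expq a u \<noteq> 1"
proof -
  have "sin (Im u) > 0" using assms by (intro sin_gt_zero) auto
  then have "norm (expq a u) < 1" unfolding norm_expq by simp
  then show ?thesis by auto
qed

lemma expq_ne_1_real:
  assumes "real n + a < exp t" "exp t < real n + 1 + a"
  shows "expq a (of_real t) \<noteq> 1"
proof
  assume "expq a (of_real t) = 1"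
  then obtain k :: int where "exp (complex_of_real t) = of_int k + of_real a"
    unfolding expq_eq_1_iff by auto
  from arg_cong[OF this, of Re] have "exp t = of_int k + a" by (simp add: exp_of_real)
  with assms have "int n < k" "k < int n + 1" by linarith+
  then show False by simp
qed

text \<open>Folding turns the horizontal edges into a real part and the vertical ones into imaginary
  parts. The main term \<open>u powr \<alpha>\<close> is left on the three upper sides; it has the
  primitive \<open>F\<close> in the right half-plane, so these contributions telescope to the
  difference of \<open>F\<close> at the real points \<open>T\<close> and \<open>e\<close>.\<close>

lemma Sum_eq_plana_kernel:
  assumes a: "0 < a" "a \<le> 1" and e: "0 < e" "e < ln (1 + a)" and N: "N \<ge> 1"
    and T: "T = ln (real N + a + 1 / 2)" and h: "0 < h" "h < pi / 2" and \<alpha>: "\<alpha> > 0"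
  shows "(\<Sum>n=1..N. ln (real n + a) powr \<alpha> / (real n + a))
           - (T powr (\<alpha> + 1) / (\<alpha> + 1) - e powr (\<alpha> + 1) / (\<alpha> + 1)) =
         2 * Im (integral {0..h} (\<lambda>t. plana_kernel \<alpha> a (Complex e t)))
         - 2 * Im (integral {0..h} (\<lambda>t. plana_kernel \<alpha> a (Complex T t)))
         - 2 * Re (integral {e..T} (\<lambda>t. plana_kernel \<alpha> a (Complex t h)))"
proof -
  let ?G = "\<lambda>u. u powr of_real \<alpha> / (expq a u - 1)"
  define F where "F = (\<lambda>u. u powr of_real (\<alpha> + 1) / complex_of_real (\<alpha> + 1))"
  note ci = contour_integral_expq(1,2)[OF a e N T h, of \<alpha>]
  have eT: "e < T" by (rule contour_integral_expq(3)[OF a e N T h])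
  have T0: "T > 0" using eT e by simp
  have img: "path_image (rectpath (Complex e (-h)) (Complex T h)) =
     {z. Re z \<in> {e, T} \<and> Im z \<in> {-h..h}} \<union> {z. Im z \<in> {-h, h} \<and> Re z \<in> {e..T}}"
    using eT h by (subst path_image_rectpath) auto
  have ne_e: "expq a (Complex e t) \<noteq> 1" if "t \<in> {0..h}" for t
  proof (cases "t = 0")
    case True
    have "exp e < 1 + a" using e a by (metis add_pos_pos exp_less_mono exp_ln zero_less_one)
    moreover have "exp e > 1" using e by simp
    then have "a < exp e" using a by linarith
    ultimately show ?thesis using expq_ne_1_real[of 0 a e] a True by (simp add: complex_of_real_def)
  next
    case False
    then show ?thesis by (intro expq_ne_1_upper) (use that h in auto)
  qed
  have ne_T: "expq a (Complex T t) \<noteq> 1" if "t \<in> {0..h}" for t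
  proof (cases "t = 0")
    case True
    have "exp T = real N + a + 1 / 2" using a unfolding T by simp
    then show ?thesis using expq_ne_1_real[of N a T] True by (simp add: complex_of_real_def)
  next
    case False
    then show ?thesis by (intro expq_ne_1_upper) (use that h in auto)
  qed
  have Ve: "integral {-h..h} (\<lambda>t. ?G (Complex e t)) =
    2 * \<i> * of_real (Im (integral {0..h} (\<lambda>t. plana_kernel \<alpha> a (Complex e t))))
    - integral {0..h} (\<lambda>t. Complex e t powr of_real \<alpha>)"
  proof (rule integral_vertical_plana_kernel[OF e(1) h(1) continuous_on_subset[OF ci(2)] ne_e])
    show "Complex e ` {-h..h} \<subseteq> path_image (rectpath (Complex e (-h)) (Complex T h))"
      unfolding img by auto
  qed auto
  have VT: "integral {-h..h} (\<lambda>t. ?G (Complex T t)) =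
    2 * \<i> * of_real (Im (integral {0..h} (\<lambda>t. plana_kernel \<alpha> a (Complex T t))))
    - integral {0..h} (\<lambda>t. Complex T t powr of_real \<alpha>)"
  proof (rule integral_vertical_plana_kernel[OF T0 h(1) continuous_on_subset[OF ci(2)] ne_T])
    show "Complex T ` {-h..h} \<subseteq> path_image (rectpath (Complex e (-h)) (Complex T h))"
      unfolding img by auto
  qed auto
  let ?H = "integral {e..T} (\<lambda>t. plana_kernel \<alpha> a (Complex t h))"
  have low: "integral {e..T} (\<lambda>t. ?G (Complex t (-h))) = - cnj ?H"
  proof -
    have "integral {e..T} (\<lambda>t. ?G (Complex t (-h))) =
        integral {e..T} (\<lambda>t. - cnj (plana_kernel \<alpha> a (Complex t h)))"
    proof (rule integral_cong)
      fix t assume "t \<in> {e..T}"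
      moreover have "Complex t (-h) = cnj (Complex t h)" by (simp add: complex_eq_iff)
      ultimately show "?G (Complex t (-h)) = - cnj (plana_kernel \<alpha> a (Complex t h))"
        using plana_kernel_cnj[of "Complex t h"] e by simp
    qed
    then show ?thesis by (simp add: integral_cnj)
  qed
  have ne_h: "expq a (Complex t h) \<noteq> 1" for t
    using h by (intro expq_ne_1_upper) auto
  have up: "integral {e..T} (\<lambda>t. ?G (Complex t h)) = ?H - integral {e..T} (\<lambda>t. Complex t h powr of_real \<alpha>)"
  proof -
    have cp: "continuous_on {e..T} (\<lambda>t. Complex t h powr of_real \<alpha>)"
      by (intro continuous_on_powr_complex continuous_on_Complex_left continuous_intros)
         (use h in \<open>auto simp: complex_nonpos_Reals_iff complex_eq_iff\<close>)
    have cG: "continuous_on {e..T} (\<lambda>t. ?G (Complex t h))"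
      by (rule continuous_on_compose2[OF ci(2) continuous_on_Complex_left]) (auto simp: img)
    have "integral {e..T} (\<lambda>t. ?G (Complex t h)) =
        integral {e..T} (\<lambda>t. plana_kernel \<alpha> a (Complex t h) - Complex t h powr of_real \<alpha>)"
      by (intro integral_cong plana_kernel_eq ne_h)
    also have "\<dots> = ?H - integral {e..T} (\<lambda>t. Complex t h powr of_real \<alpha>)"
    proof (rule integral_diff)
      have "(\<lambda>t. ?G (Complex t h) + Complex t h powr of_real \<alpha>) integrable_on {e..T}"
        by (intro integrable_continuous_real continuous_on_add cp cG)
      then show "(\<lambda>t. plana_kernel \<alpha> a (Complex t h)) integrable_on {e..T}"
        by (rule integrable_eq) (use ne_h in \<open>simp add: plana_kernel_eq\<close>)
      show "(\<lambda>t. Complex t h powr of_real \<alpha>) integrable_on {e..T}"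
        by (intro integrable_continuous_real cp)
    qed
    finally show ?thesis .
  qed
  have P: "integral {e..T} (\<lambda>t. Complex t h powr of_real \<alpha>) = F (Complex T h) - F (Complex e h)"
    using contour_integral_powr_linepath[of "Complex e h" "Complex T h" \<alpha>] e T0 \<alpha>
      contour_integral_linepath_Complex_horizontal[OF eT, of h "\<lambda>u. u powr of_real \<alpha>"]
    by (simp add: F_def)
  have Q: "F (Complex b h) = F (of_real b) + \<i> * integral {0..h} (\<lambda>t. Complex b t powr of_real \<alpha>)"
    if "b > 0" for b
    using contour_integral_powr_linepath[of "Complex b 0" "Complex b h" \<alpha>] that \<alpha>
      contour_integral_linepath_Complex_vertical[OF h(1), of b "\<lambda>u. u powr of_real \<alpha>"]
    by (simp add: F_def complex_of_real_def diff_eq_eq add.commute)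
  have Fr: "F (of_real b) = of_real (b powr (\<alpha> + 1) / (\<alpha> + 1))" if "b > 0" for b
    using that powr_of_real[of b "\<alpha> + 1"] by (simp add: F_def)
  have "of_real (\<Sum>n=1..N. ln (real n + a) powr \<alpha> / (real n + a)) =
      integral {e..T} (\<lambda>t. ?G (Complex t (-h))) + \<i> * integral {-h..h} (\<lambda>t. ?G (Complex T t))
    - integral {e..T} (\<lambda>t. ?G (Complex t h)) - \<i> * integral {-h..h} (\<lambda>t. ?G (Complex e t))"
    unfolding ci(1)[symmetric]
    by (rule contour_integral_rectpath_Complex[OF eT _ ci(2)]) (use h in simp)
  also have "\<dots> = - cnj ?H - ?H + (F (of_real T) - F (of_real e))
     + \<i> * (2 * \<i> * of_real (Im (integral {0..h} (\<lambda>t. plana_kernel \<alpha> a (Complex T t)))))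
     - \<i> * (2 * \<i> * of_real (Im (integral {0..h} (\<lambda>t. plana_kernel \<alpha> a (Complex e t)))))"
    unfolding low up Ve VT P Q[OF T0] Q[OF e(1)] by (simp add: algebra_simps)
  finally have "complex_of_real (\<Sum>n=1..N. ln (real n + a) powr \<alpha> / (real n + a)) = \<dots>" .
  from arg_cong[OF this, of Re] show ?thesis
    unfolding Fr[OF T0] Fr[OF e(1)] by (simp add: Re_sum del: of_real_divide of_real_sum)
qed

subsection \<open>The limit of the left edge\<close>

text \<open>Up to \<open>pi / 3\<close> the cosine stays above 1/4; beyond that the sine is at least
  1/2 while \<open>x / 4 \<le> pi / 8\<close>. The constant suffices for
  \<open>2 pi sin x \<ge> x\<close>.\<close>

lemma sin_ge_quarter:
  assumes "0 \<le> x" "x \<le> pi / 2"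
  shows "x / 4 \<le> sin (x::real)"
proof (cases "x \<le> pi / 3")
  case True
  have "sin 0 - 0 / 4 \<le> sin x - x / 4"
  proof (rule DERIV_nonneg_imp_nondecreasing[OF assms(1)])
    fix t assume "0 \<le> t" "t \<le> x"
    then have "cos (pi / 3) \<le> cos t" using True by (intro cos_monotone_0_pi_le) auto
    then have "0 \<le> cos t - 1 / 4" by (simp add: cos_60)
    moreover have "((\<lambda>x. sin x - x / 4) has_real_derivative cos t - 1 / 4) (at t)"
      by (auto intro!: derivative_eq_intros)
    ultimately show "\<exists>y. ((\<lambda>x. sin x - x / 4) has_real_derivative y) (at t) \<and> 0 \<le> y"
      by blast
  qed
  then show ?thesis by simp
next
  case False
  have "sin (pi / 6) \<le> sin x" using False assms by (intro sin_monotone_2pi_le) auto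
  then show ?thesis using assms pi_less_4 by (simp add: sin_30)
qed

text \<open>Only the corner \<open>u = 0\<close> is delicate. There \<open>powr\<close> has its
  branch point, and for \<open>a = 1\<close> the denominator vanishes as well. Writing the kernel as
  \<open>u powr (\<alpha> - 1)\<close> times \<open>u / (q - 1)\<close> times \<open>q\<close>, the
  second factor has a finite limit even at a simple zero of \<open>q - 1\<close>, and the first
  tends to 0 because \<open>\<alpha> > 1\<close>.\<close>

lemma continuous_on_plana_kernel:
  assumes a: "0 < a" "a \<le> 1" and b: "b < ln (1 + a)" and h: "h < pi / 2" and \<alpha>: "\<alpha> > 1"
  shows "continuous_on {u. 0 \<le> Re u \<and> Re u \<le> b \<and> 0 \<le> Im u \<and> Im u \<le> h} (plana_kernel \<alpha> a)"
    (is "continuous_on ?K _")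
  unfolding continuous_on_eq_continuous_within
proof
  fix u assume u: "u \<in> ?K"
  have cq: "isCont (expq a) u" for u
    using expq_has_field_derivative[of a u] by (rule DERIV_isCont)
  show "continuous (at u within ?K) (plana_kernel \<alpha> a)"
  proof (cases "u = 0")
    case False
    have "u \<notin> \<real>\<^sub>\<le>\<^sub>0" using u False by (auto simp: complex_nonpos_Reals_iff complex_eq_iff)
    moreover have "expq a u \<noteq> 1"
    proof (cases "Im u = 0")
      case True
      then have r: "u = of_real (Re u)" by (simp add: complex_eq_iff)
      have "exp (Re u) < exp (ln (1 + a))" using u b by auto
      then have "exp (Re u) < 1 + a" using a by simp
      moreover have "Re u > 0" using u False True by (auto simp: complex_eq_iff less_le)
      then have "1 < exp (Re u)" by simp
      then have "a < exp (Re u)" using a by linarith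
      ultimately show ?thesis using expq_ne_1_real[of 0 a "Re u"] by (subst r) simp
    next
      case False
      then show ?thesis using u h pi_gt_zero by (intro expq_ne_1_upper) auto
    qed
    ultimately have "isCont (plana_kernel \<alpha> a) u"
      unfolding plana_kernel_def using cq by (intro continuous_intros) auto
    then show ?thesis by (rule continuous_at_imp_continuous_within)
  next
    case u0: True
    have "((\<lambda>u. norm (u powr of_real (\<alpha> - 1))) \<longlongrightarrow> 0 powr (\<alpha> - 1)) (at (0::complex))"
      unfolding norm_powr_real_powr'[OF Reals_of_real] using \<alpha>
      by (auto intro!: tendsto_eq_intros)
    then have t1: "((\<lambda>u. u powr of_real (\<alpha> - 1)) \<longlongrightarrow> 0) (at (0::complex))"
      by (simp add: tendsto_norm_zero_iff)
    have "\<exists>l. ((\<lambda>u. u / (expq a u - 1)) \<longlongrightarrow> l) (at 0)"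
    proof (cases "expq a 0 = 1")
      case True
      have "((\<lambda>u. (expq a u - expq a 0) / (u - 0)) \<longlongrightarrow> expq a 0 * (2 * of_real pi * \<i> * exp 0)) (at 0)"
        using expq_has_field_derivative[of a 0] by (simp add: has_field_derivative_iff)
      then have "((\<lambda>u. inverse ((expq a u - 1) / u)) \<longlongrightarrow> inverse (2 * of_real pi * \<i>)) (at 0)"
        using True by (intro tendsto_inverse) auto
      then show ?thesis by auto
    next
      case False
      have "((\<lambda>u. u / (expq a u - 1)) \<longlongrightarrow> 0 / (expq a 0 - 1)) (at 0)"
        using cq[of 0] False by (intro tendsto_intros) (auto simp: isCont_def)
      then show ?thesis by auto
    qed
    then obtain l where t2: "((\<lambda>u. u / (expq a u - 1)) \<longlongrightarrow> l) (at 0)" by blast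
    have "((\<lambda>u. u powr of_real (\<alpha> - 1) * (u / (expq a u - 1)) * expq a u) \<longlongrightarrow> 0 * l * expq a 0) (at 0)"
      using cq[of 0] by (intro tendsto_mult t1 t2) (auto simp: isCont_def)
    moreover have "\<forall>\<^sub>F u in at 0. u powr of_real (\<alpha> - 1) * (u / (expq a u - 1)) * expq a u = plana_kernel \<alpha> a u"
      by (rule eventually_mono[OF eventually_neq_at_within[of 0]])
         (simp add: plana_kernel_def powr_diff)
    ultimately have "(plana_kernel \<alpha> a \<longlongrightarrow> 0 * l * expq a 0) (at 0)"
      by (rule Lim_transform_eventually)
    \<comment> \<open>The limit 0 is also the value at the corner, because \<open>0 powr _\<close>
      is 0.\<close>
    then have "isCont (plana_kernel \<alpha> a) 0"
      by (simp add: isCont_def plana_kernel_def)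
    then show ?thesis
      unfolding u0 by (rule continuous_at_imp_continuous_within)
  qed
qed

lemma continuous_on_plana_kernel_horizontal:
  assumes "0 < h" "h < pi" "\<alpha> > 0"
  shows "continuous_on A (\<lambda>t. plana_kernel \<alpha> a (Complex t h))"
proof -
  have "expq a (Complex t h) \<noteq> 1" for t
    using assms by (intro expq_ne_1_upper) auto
  then show ?thesis
    unfolding plana_kernel_def using assms
    by (intro continuous_intros continuous_on_powr_complex continuous_on_Complex_left)
       (simp_all add: complex_nonpos_Reals_iff complex_eq_iff)
qed

lemma Sum_eq_plana_kernel_0:
  assumes a: "0 < a" "a \<le> 1" and N: "N \<ge> 1"
    and T: "T = ln (real N + a + 1 / 2)" and h: "0 < h" "h < pi / 2" and \<alpha>: "\<alpha> > 1"
  shows "(\<Sum>n=1..N. ln (real n + a) powr \<alpha> / (real n + a)) - T powr (\<alpha> + 1) / (\<alpha> + 1) =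
         2 * Im (integral {0..h} (\<lambda>t. plana_kernel \<alpha> a (Complex 0 t)))
         - 2 * Im (integral {0..h} (\<lambda>t. plana_kernel \<alpha> a (Complex T t)))
         - 2 * Re (integral {0..T} (\<lambda>t. plana_kernel \<alpha> a (Complex t h)))"
proof -
  \<comment> \<open>Left edges with abscissa in \<open>{0..b}\<close> stay strictly before the first
    pole.\<close>
  define b where "b = ln (1 + a) / 2"
  have b: "0 < b" "b < ln (1 + a)" using a by (auto simp: b_def)
  have "ln (1 + a) \<le> T" unfolding T using a N by simp
  then have bT: "b \<le> T" using b by linarith
  \<comment> \<open>\<open>D e\<close> is the difference of the two sides of the identity for left
    edge \<open>e\<close>. It is continuous on \<open>{0..b}\<close> and vanishes inside, hence also
    at 0.\<close>
  define D where "D = (\<lambda>e. (\<Sum>n=1..N. ln (real n + a) powr \<alpha> / (real n + a))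
           - (T powr (\<alpha> + 1) / (\<alpha> + 1) - e powr (\<alpha> + 1) / (\<alpha> + 1)) -
         (2 * Im (integral {0..h} (\<lambda>t. plana_kernel \<alpha> a (Complex e t)))
         - 2 * Im (integral {0..h} (\<lambda>t. plana_kernel \<alpha> a (Complex T t)))
         - 2 * Re (integral {e..T} (\<lambda>t. plana_kernel \<alpha> a (Complex t h)))))"
  have c1: "continuous_on {0..b} (\<lambda>e. integral {0..h} (\<lambda>t. plana_kernel \<alpha> a (Complex e t)))"
  proof -
    have "continuous_on ({0..b} \<times> cbox 0 h) (\<lambda>(e, t). plana_kernel \<alpha> a (Complex e t))"
      unfolding case_prod_unfold
    proof (rule continuous_on_compose2[OF continuous_on_plana_kernel[OF a b(2) h(2) \<alpha>]])
      show "continuous_on ({0..b} \<times> cbox 0 h) (\<lambda>x. Complex (fst x) (snd x))"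
        unfolding Complex_eq by (intro continuous_intros)
    qed auto
    from integral_continuous_on_param[OF this] show ?thesis by simp
  qed
  have "(\<lambda>t. plana_kernel \<alpha> a (Complex t h)) integrable_on {0..T}"
    by (intro integrable_continuous_real continuous_on_plana_kernel_horizontal) (use h \<alpha> in auto)
  from indefinite_integral_continuous_1'[OF this]
  have c2: "continuous_on {0..b} (\<lambda>e. integral {e..T} (\<lambda>t. plana_kernel \<alpha> a (Complex t h)))"
    by (rule continuous_on_subset) (use bT in auto)
  have c3: "continuous_on {0..b} (\<lambda>e. e powr (\<alpha> + 1))"
    using \<alpha> by (intro continuous_on_powr' continuous_intros) auto
  have "continuous_on {0..b} D"
    unfolding D_def divide_inverse
    by (intro continuous_on_diff continuous_on_mult continuous_on_const continuous_on_Im continuous_on_Re c1 c2 c3)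
  moreover have "D e = 0" if "e \<in> {0<..<b}" for e
    using Sum_eq_plana_kernel[OF a _ _ N T h, of e \<alpha>] that b \<alpha> by (simp add: D_def)
  ultimately have "D 0 = 0"
    using b continuous_constant_on_closure[of "{0<..<b}" D 0 0] closure_greaterThanLessThan[OF b(1)] by simp
  then show ?thesis using \<alpha> unfolding D_def by simp
qed

lemma norm_plana_kernel:
  "norm (plana_kernel \<alpha> a u) = norm u powr \<alpha> * (norm (expq a u) / norm (expq a u - 1))"
  by (simp add: plana_kernel_def norm_mult norm_divide norm_powr_real_powr')

text \<open>Either \<open>q\<close> is small, or \<open>t\<close> is so close to the real axis that
  the argument of \<open>q\<close> stays near an odd multiple of \<open>pi\<close>, the value it has
  at the midpoint \<open>N + a + 1/2\<close>. Then \<open>Re q \<le> 0\<close>.\<close>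

lemma norm_expq_minus_1_ge:
  assumes a: "0 < a" and N: "N \<ge> 1" and T: "T = ln (real N + a + 1 / 2)" and t: "0 \<le> t" "t \<le> pi / 2"
  shows "norm (expq a (Complex T t) - 1) \<ge> 1 / 2"
proof (cases "norm (expq a (Complex T t)) \<le> 1 / 2")
  case True
  then show ?thesis using norm_triangle_ineq2[of 1 "expq a (Complex T t)"] by (simp add: norm_minus_commute)
next
  case False
  define X where "X = real N + a + 1 / 2"
  have X: "X \<ge> 1" "exp T = X" using a N by (auto simp: X_def T)
  have q: "norm (expq a (Complex T t)) = exp (- (2 * pi * X * sin t))"
    by (simp add: norm_expq X)
  have "exp (- 1) < exp (- (2 * pi * X * sin t))"
  proof -
    have "2 \<le> exp (1::real)" using exp_ge_add_one_self[of 1] by simp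
    then have "exp (-1) \<le> (1 / 2 :: real)" by (simp add: exp_minus field_simps)
    then show ?thesis using False q by linarith
  qed
  then have s: "2 * pi * X * sin t < 1" by simp
  have st: "0 \<le> sin t" "0 \<le> cos t" using t by (auto intro!: sin_ge_zero cos_ge_zero)
  \<comment> \<open>\<open>\<phi>\<close> is the deviation of the argument of \<open>q\<close> from
    an odd multiple of \<open>pi\<close>. Since \<open>1 - cos t \<le> sin t\<close>, it is at most
    \<open>2 pi X sin t < 1 < pi / 2\<close>.\<close>
  define \<phi> where "\<phi> = 2 * pi * X * (1 - cos t)"
  have "1 - cos t \<le> (sin t)\<^sup>2"
    using st mult_left_mono[OF cos_le_one[of t] st(2)] sin_cos_squared_add[of t] by (simp add: power2_eq_square)
  also have "\<dots> \<le> sin t" using st sin_le_one[of t] mult_left_mono[of "sin t" 1 "sin t"] by (simp add: power2_eq_square)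
  finally have "\<phi> \<le> 2 * pi * X * sin t" unfolding \<phi>_def using X by (intro mult_left_mono) auto
  then have "\<phi> \<le> pi / 2" using s pi_ge_two by linarith
  moreover have "\<phi> \<ge> 0" unfolding \<phi>_def using X by simp
  ultimately have cphi: "cos \<phi> \<ge> 0" by (intro cos_ge_zero) auto
  have "Re (expq a (Complex T t)) = exp (- (2 * pi * X * sin t)) * cos (2 * pi * (X * cos t - a))"
    unfolding expq_def by (simp add: Re_exp Im_exp X algebra_simps)
  also have "2 * pi * (X * cos t - a) = real N * (2 * pi) + (pi - \<phi>)"
    unfolding \<phi>_def X_def by (simp add: algebra_simps)
  also have "cos \<dots> = - cos \<phi>"
  proof -
    have "cos (real N * (2 * pi) + (pi - \<phi>)) = cos (pi - \<phi>)"
      using cos.plus_of_nat[of "pi - \<phi>" N] by (simp add: add.commute)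
    then show ?thesis by simp
  qed
  finally have "Re (expq a (Complex T t) - 1) \<le> - 1" using cphi by simp
  then show ?thesis using abs_Re_le_cmod[of "expq a (Complex T t) - 1"] by linarith
qed

subsection \<open>Bounds on the edges\<close>

text \<open>The bound is free of the length \<open>b\<close>. For the top edge it is therefore
  uniform in \<open>N\<close>, and for the right edge it profits from a rate \<open>c\<close> that
  grows with \<open>N\<close>.\<close>

lemma norm_integral_le_exp:
  fixes f :: "real \<Rightarrow> complex"
  assumes "f integrable_on {0..b}" "b \<ge> 0" "A \<ge> 0" "c > 0"
    and "\<And>t. t \<in> {0..b} \<Longrightarrow> norm (f t) \<le> A * exp (- c * t)"
  shows "norm (integral {0..b} f) \<le> A / c"
proof -
  have "((\<lambda>t. A * exp (- c * t)) has_integral (- A / c * exp (- c * b) - - A / c * exp (- c * 0))) {0..b}"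
    using assms
    by (intro fundamental_theorem_of_calculus)
       (auto intro!: derivative_eq_intros simp: has_real_derivative_iff_has_vector_derivative[symmetric])
  note I = this
  have "norm (integral {0..b} f) \<le> integral {0..b} (\<lambda>t. A * exp (- c * t))"
    using assms I by (intro integral_norm_bound_integral) (auto simp: integrable_on_def)
  also have "\<dots> = A / c - A / c * exp (- c * b)"
    using integral_unique[OF I] by simp
  also have "\<dots> \<le> A / c" using assms by simp
  finally show ?thesis .
qed

text \<open>Along this edge \<open>q\<close> decays at rate \<open>exp T\<close>, so the estimate is
  a power of a logarithm divided by \<open>N + a + 1/2\<close> and tends to 0. The summand 2 in
  \<open>T + 2\<close> covers the height \<open>h < pi / 2\<close>, the factor 2 the distance 1/2 of
  \<open>q\<close> from 1.\<close>

lemma norm_plana_kernel_right_edge: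
  assumes a: "0 < a" and N: "N \<ge> 1" and T: "T = ln (real N + a + 1 / 2)" and h: "0 < h" "h < pi / 2"
    and \<alpha>: "\<alpha> > 0"
  shows "norm (integral {0..h} (\<lambda>t. plana_kernel \<alpha> a (Complex T t))) \<le>
           2 * (T + 2) powr \<alpha> / (real N + a + 1 / 2)"
proof (rule norm_integral_le_exp)
  define X where "X = real N + a + 1 / 2"
  have X: "X \<ge> 1" "exp T = X" using a N by (auto simp: X_def T)
  have T0: "T > 0" unfolding T using a N by simp
  have ge: "norm (expq a (Complex T t) - 1) \<ge> 1 / 2" if "t \<in> {0..h}" for t
    using that h by (intro norm_expq_minus_1_ge[OF a N T]) auto
  have ne: "expq a (Complex T t) \<noteq> 1" if "t \<in> {0..h}" for t
    using ge[OF that] by auto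
  show "(\<lambda>t. plana_kernel \<alpha> a (Complex T t)) integrable_on {0..h}"
    unfolding plana_kernel_def using ne T0 \<alpha>
    by (intro integrable_continuous_real continuous_intros continuous_on_powr_complex continuous_on_Complex_right)
       (simp_all add: complex_nonpos_Reals_iff complex_eq_iff)
  fix t assume t: "t \<in> {0..h}"
  have "norm (Complex T t) \<le> T + 2"
    using cmod_le[of "Complex T t"] t h T0 pi_less_4 by simp
  then have 1: "norm (Complex T t) powr \<alpha> \<le> (T + 2) powr \<alpha>"
    using \<alpha> by (intro powr_mono2) auto
  have "t \<le> 2 * pi * (t / 4)" using pi_ge_two t mult_right_mono[of 2 pi t] by simp
  also have "\<dots> \<le> 2 * pi * sin t"
    using t h by (intro mult_left_mono sin_ge_quarter) auto
  finally have "X * t \<le> X * (2 * pi * sin t)" using X by (intro mult_left_mono) auto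
  then have "norm (expq a (Complex T t)) \<le> exp (- X * t)"
    by (simp add: norm_expq X algebra_simps)
  then have "norm (expq a (Complex T t)) / norm (expq a (Complex T t) - 1) \<le> exp (- X * t) / (1 / 2)"
    using ge[OF t] by (intro frac_le) auto
  with 1 have "norm (plana_kernel \<alpha> a (Complex T t)) \<le> (T + 2) powr \<alpha> * (exp (- X * t) / (1 / 2))"
    unfolding norm_plana_kernel by (intro mult_mono) auto
  then show "norm (plana_kernel \<alpha> a (Complex T t)) \<le>
      2 * (T + 2) powr \<alpha> * exp (- (real N + a + 1 / 2) * t)"
    unfolding X_def by (simp add: mult_ac)
qed (use h a in auto)

lemma norm_plana_kernel_le:
  assumes "norm (expq a u) < 1"
  shows "norm (plana_kernel \<alpha> a u) \<le>
           norm u powr \<alpha> * (norm (expq a u) / (1 - norm (expq a u)))"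
proof -
  have "1 - norm (expq a u) \<le> norm (expq a u - 1)"
    using norm_triangle_ineq2[of 1 "expq a u"] by (simp add: norm_minus_commute)
  then show ?thesis
    unfolding norm_plana_kernel using assms by (intro mult_left_mono divide_left_mono mult_pos_pos) auto
qed

text \<open>With \<open>y = 2 pi sin t \<ge> t\<close> the quotient is at most
  \<open>1 / (exp y - 1) \<le> 1 / y \<le> 1 / t\<close>: the possible pole at 0 costs one power of
  \<open>t\<close>.\<close>

lemma norm_plana_kernel_left_edge:
  assumes t: "0 < t" "t \<le> h" and h: "h < pi / 2"
  shows "norm (plana_kernel \<alpha> a (Complex 0 t)) \<le> t powr (\<alpha> - 1)"
proof -
  define y where "y = 2 * pi * sin t"
  have "t \<le> 2 * pi * (t / 4)" using pi_ge_two t mult_right_mono[of 2 pi t] by simp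
  also have "\<dots> \<le> y"
    unfolding y_def using t h by (intro mult_left_mono sin_ge_quarter) auto
  finally have ty: "t \<le> y" .
  have q: "norm (expq a (Complex 0 t)) = exp (- y)"
    by (simp add: norm_expq y_def)
  have "exp (- y) / (1 - exp (- y)) \<le> 1 / t"
  proof -
    have "y * exp (- y) + exp (- y) \<le> 1"
      using mult_left_mono[OF exp_ge_add_one_self[of y], of "exp (- y)"]
      by (simp add: exp_minus field_simps)
    moreover have "t * exp (- y) \<le> y * exp (- y)" using ty by simp
    ultimately have "t * exp (- y) \<le> 1 - exp (- y)" by linarith
    moreover have "0 < 1 - exp (- y)" using ty t by simp
    ultimately show ?thesis using t by (simp add: field_simps)
  qed
  moreover have "norm (Complex 0 t) = t" using t by (simp add: cmod_def)
  ultimately have "norm (plana_kernel \<alpha> a (Complex 0 t)) \<le> t powr \<alpha> * (1 / t)"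
    using norm_plana_kernel_le[of a "Complex 0 t" \<alpha>] ty t unfolding q
    by (smt (verit) exp_less_one_iff mult_left_mono powr_ge_zero)
  then show ?thesis using t by (simp add: powr_diff)
qed

text \<open>The condition on \<open>sin h\<close> keeps \<open>norm q\<close> below
  \<open>exp (- 1) \<le> 1 / 2\<close> on the whole edge; the denominator then costs at most the
  factor 2.\<close>

lemma norm_plana_kernel_top_edge:
  assumes "t \<ge> 0" "1 \<le> 2 * pi * sin h"
  shows "norm (plana_kernel \<alpha> a (Complex t h)) \<le>
           2 * (norm (Complex t h) powr \<alpha> * exp (- 2 * pi * exp t * sin h))"
proof -
  have "1 * 1 \<le> exp t * (2 * pi * sin h)" using assms by (intro mult_mono) auto
  then have y: "1 \<le> 2 * pi * exp t * sin h" by (simp add: mult_ac)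
  then have "norm (expq a (Complex t h)) \<le> exp (- 1)" by (simp add: norm_expq)
  also have "\<dots> \<le> 1 / 2"
    using exp_ge_add_one_self[of "1::real"] by (simp add: exp_minus field_simps)
  finally have q: "norm (expq a (Complex t h)) \<le> 1 / 2" .
  then have "norm (plana_kernel \<alpha> a (Complex t h)) \<le>
      norm (Complex t h) powr \<alpha> * (norm (expq a (Complex t h)) / (1 - norm (expq a (Complex t h))))"
    by (intro norm_plana_kernel_le) auto
  also have "\<dots> \<le> norm (Complex t h) powr \<alpha> * (norm (expq a (Complex t h)) / (1 / 2))"
    using q by (intro mult_left_mono divide_left_mono) auto
  finally show ?thesis by (simp add: norm_expq)
qed

text \<open>The upper and the lower half of the contour each contribute at most half of the bound; the edge
  \<open>Re u = T\<close> disappears in the limit.\<close>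
lemma abs_stieltjes_C_le:
  assumes a: "0 < a" "a \<le> 1" and \<alpha>: "\<alpha> > 1" and h: "0 < h" "h < pi / 2" "1 \<le> 2 * pi * sin h"
    and c: "c > 0" and A: "A \<ge> 0"
    and left: "\<And>t. 0 < t \<Longrightarrow> t \<le> h \<Longrightarrow> t powr (\<alpha> - 1) \<le> L"
    and top: "\<And>t. 0 \<le> t \<Longrightarrow> norm (Complex t h) powr \<alpha> * exp (- 2 * pi * exp t * sin h) \<le> A * exp (- c * t)"
  shows "\<bar>stieltjes_C \<alpha> a\<bar> \<le> 2 * h * L + 4 * A / c"
proof -
  define F where "F = (\<lambda>x::real. x powr (\<alpha> + 1) / (\<alpha> + 1))"
  define S where "S = (\<lambda>N. \<Sum>n=1..N. ln (real n + a) powr \<alpha> / (real n + a))"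
  define T where "T = (\<lambda>N. ln (real N + a + 1 / 2))"
  have L: "0 \<le> L" using left[of h] h by (smt (verit) powr_ge_zero)
  have "(\<lambda>N. S N - F (ln (real N + a))) \<longlonglongrightarrow> stieltjes_C \<alpha> a"
    using convergent_stieltjes_C[of \<alpha> a] a \<alpha> unfolding stieltjes_C_def S_def F_def
    by (simp add: convergent_LIMSEQ_iff)
  \<comment> \<open>The constant is defined with the main term at \<open>N + a\<close>, whereas the
    contour ends at \<open>N + a + 1/2\<close>; the shift is negligible in the limit.\<close>
  moreover have "(\<lambda>N. F (ln (real N + a)) - F (T N)) \<longlonglongrightarrow> 0"
    using \<alpha> a unfolding F_def T_def by real_asymp
  ultimately have "(\<lambda>N. (S N - F (ln (real N + a))) + (F (ln (real N + a)) - F (T N))) \<longlonglongrightarrow> stieltjes_C \<alpha> a + 0"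
    by (rule tendsto_add)
  then have lim: "(\<lambda>N. S N - F (T N)) \<longlonglongrightarrow> stieltjes_C \<alpha> a" by simp
  let ?l = "integral {0..h} (\<lambda>t. plana_kernel \<alpha> a (Complex 0 t))"
  have cont: "continuous_on {0..h} (\<lambda>t. plana_kernel \<alpha> a (Complex 0 t))"
  proof (rule continuous_on_compose2[OF continuous_on_plana_kernel[OF a _ h(2) \<alpha>, of 0] continuous_on_Complex_right])
    show "0 < ln (1 + a)" using a by simp
  qed auto
  have "norm ?l \<le> L * (h - 0)"
  proof (rule integral_bound)
    show "norm (plana_kernel \<alpha> a (Complex 0 t)) \<le> L" if "t \<in> {0..h}" for t
    proof (cases "t = 0")
      case True
      have "Complex 0 0 = 0" by (simp add: complex_eq_iff)
      then show ?thesis using True L by (simp add: plana_kernel_def)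
    next
      case False
      then show ?thesis
        using norm_plana_kernel_left_edge[of t h \<alpha> a] left[of t] that h by auto
    qed
  qed (use h cont in auto)
  then have l: "\<bar>Im ?l\<bar> \<le> h * L"
    using abs_Im_le_cmod[of ?l] by (simp add: mult_ac)
  have bound: "\<bar>S N - F (T N)\<bar> \<le> 2 * h * L + 4 * A / c + 4 * (T N + 2) powr \<alpha> / (real N + a + 1 / 2)"
    if N: "N \<ge> 1" for N
  proof -
    let ?r = "integral {0..h} (\<lambda>t. plana_kernel \<alpha> a (Complex (T N) t))"
    let ?t = "integral {0..T N} (\<lambda>t. plana_kernel \<alpha> a (Complex t h))"
    have T0: "T N \<ge> 0" unfolding T_def using a N by simp
    have eq: "S N - F (T N) = 2 * Im ?l - 2 * Im ?r - 2 * Re ?t"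
      using Sum_eq_plana_kernel_0[OF a N _ h(1,2) \<alpha>] by (simp add: S_def F_def T_def)
    have "norm ?r \<le> 2 * (T N + 2) powr \<alpha> / (real N + a + 1 / 2)"
      using norm_plana_kernel_right_edge[OF a(1) N _ h(1,2)] \<alpha> by (simp add: T_def)
    then have r: "\<bar>Im ?r\<bar> \<le> 2 * (T N + 2) powr \<alpha> / (real N + a + 1 / 2)"
      using abs_Im_le_cmod[of ?r] by linarith
    have "norm ?t \<le> 2 * A / c"
    proof (rule norm_integral_le_exp)
      show "(\<lambda>t. plana_kernel \<alpha> a (Complex t h)) integrable_on {0..T N}"
        by (intro integrable_continuous_real continuous_on_plana_kernel_horizontal) (use h \<alpha> in auto)
      show "norm (plana_kernel \<alpha> a (Complex t h)) \<le> 2 * A * exp (- c * t)" if "t \<in> {0..T N}" for t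
        using norm_plana_kernel_top_edge[of t h \<alpha> a] top[of t] h that by auto
    qed (use T0 A c in auto)
    then have t: "\<bar>Re ?t\<bar> \<le> 2 * A / c"
      using abs_Re_le_cmod[of ?t] by linarith
    show ?thesis unfolding eq using l r t by (simp add: abs_if split: if_splits)
  qed
  have "(\<lambda>N. 4 * (T N + 2) powr \<alpha> / (real N + a + 1 / 2)) \<longlonglongrightarrow> 0"
    unfolding T_def using a \<alpha> by real_asymp
  then have "(\<lambda>N. 2 * h * L + 4 * A / c + 4 * (T N + 2) powr \<alpha> / (real N + a + 1 / 2)) \<longlonglongrightarrow> 2 * h * L + 4 * A / c + 0"
    by (intro tendsto_add tendsto_const)
  then show ?thesis
    using tendsto_le[OF sequentially_bot _ tendsto_rabs[OF lim], of _ "2 * h * L + 4 * A / c + 0"]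
      eventually_sequentiallyI[of 1 "\<lambda>N. \<bar>S N - F (T N)\<bar> \<le> 2 * h * L + 4 * A / c + 4 * (T N + 2) powr \<alpha> / (real N + a + 1 / 2)"]
      bound by simp
qed

subsection \<open>The Lambert function on the positive imaginary axis\<close>

text \<open>The imaginary part \<open>\<theta>\<close> of \<open>w = lambert_W0 (\<i> * y)\<close> is determined by \<open>lambert_curve \<theta> = y\<close>, and
  \<open>Re w = \<theta> * tan \<theta>\<close>.\<close>
definition lambert_curve :: "real \<Rightarrow> real" where
  "lambert_curve \<theta> = exp (\<theta> * tan \<theta>) * (\<theta> / cos \<theta>)"

lemma lambert_curve_strict_mono:
  assumes "0 < x" "x < y" "y < pi / 2"
  shows "lambert_curve x < lambert_curve y"
proof -
  have c: "0 < cos y" "cos y < cos x"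
    using assms by (auto intro!: cos_gt_zero_pi cos_monotone_0_pi)
  have t: "0 < tan x" "tan x < tan y"
    using assms by (auto intro!: tan_gt_zero tan_monotone)
  have "x * tan x < y * tan y" using assms t by (intro mult_strict_mono) auto
  moreover have "x / cos x < y / cos y"
    using assms c by (intro frac_less) auto
  ultimately show ?thesis
    unfolding lambert_curve_def using assms c by (intro mult_strict_mono) auto
qed

lemma lambert_curve_surj:
  assumes "y > 0"
  obtains \<theta> where "0 < \<theta>" "\<theta> < pi / 2" "lambert_curve \<theta> = y"
proof -
  \<comment> \<open>With \<open>cos b = m\<close>, the bound \<open>cos 1\<close> gives
    \<open>b \<ge> 1\<close>, and the bound \<open>1 / (y + 1)\<close> then gives
    \<open>b / cos b \<ge> y\<close>. So the intermediate value theorem applies on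
    \<open>{0..b}\<close>.\<close>
  define m where "m = min (cos 1) (1 / (y + 1))"
  have "0 < cos (1::real)" using pi_approx by (intro cos_gt_zero_pi) auto
  then have m: "0 < m" "m \<le> cos 1" "m \<le> 1 / (y + 1)" using assms by (auto simp: m_def)
  define b where "b = arccos m"
  have m1: "m \<le> 1" using m(2) cos_le_one[of "1::real"] by linarith
  have cb: "cos b = m" unfolding b_def using m m1 by (intro cos_arccos) auto
  have b1: "1 \<le> b"
  proof -
    have "arccos (cos 1) \<le> b"
      unfolding b_def using m m1 by (intro arccos_le_arccos) auto
    then show ?thesis using pi_approx by (simp add: arccos_cos)
  qed
  have b2: "b < pi / 2"
  proof -
    have "b < arccos 0" unfolding b_def using m m1 by (intro arccos_less_arccos) auto
    then show ?thesis by simp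
  qed
  have pos: "cos x > 0" if "0 \<le> x" "x \<le> b" for x
    using that b2 by (intro cos_gt_zero_pi) auto
  have "y * m \<le> y * (1 / (y + 1))" using m(3) assms by (intro mult_left_mono) auto
  also have "\<dots> \<le> 1" using assms by simp
  finally have "y * m \<le> 1" .
  then have "y \<le> b / cos b" unfolding cb using m b1 by (simp add: pos_le_divide_eq)
  also have "\<dots> \<le> lambert_curve b"
    unfolding lambert_curve_def
    using mult_right_mono[of 1 "exp (b * tan b)" "b / cos b"] b1 pos[of b] tan_gt_zero[of b] b2 by simp
  finally have "y \<le> lambert_curve b" .
  moreover have "lambert_curve 0 \<le> y" using assms by (simp add: lambert_curve_def)
  moreover have "continuous_on {0..b} lambert_curve"
    unfolding lambert_curve_def using pos by (intro continuous_intros) (auto simp: less_imp_neq[symmetric])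
  ultimately obtain x where x: "0 \<le> x" "x \<le> b" "lambert_curve x = y"
    using IVT'[of lambert_curve 0 y b] b1 by auto
  moreover have "x \<noteq> 0" using x assms by (auto simp: lambert_curve_def)
  ultimately show ?thesis using that[of x] b2 by auto
qed

lemma tan_sin_plus_cos:
  assumes "cos t \<noteq> (0::real)"
  shows "t * tan t * sin t + t * cos t = t / cos t"
proof -
  have "t * (sin t * sin t) + t * (cos t * cos t) = t * ((sin t)\<^sup>2 + (cos t)\<^sup>2)"
    by (simp only: power2_eq_square distrib_left)
  then have "t * (sin t * sin t) + t * (cos t * cos t) = t" by simp
  then show ?thesis using assms by (simp add: tan_def field_simps)
qed

lemma tan_square_plus_square:
  assumes "cos t \<noteq> (0::real)"
  shows "(t * tan t)\<^sup>2 + t\<^sup>2 = (t / cos t)\<^sup>2"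
proof -
  have "(t * tan t)\<^sup>2 + t\<^sup>2 = t\<^sup>2 * (1 + (tan t)\<^sup>2)"
    by (simp add: power_mult_distrib distrib_left)
  then show ?thesis
    using tan_sec[OF assms] by (simp add: power_divide divide_inverse power_inverse power_mult_distrib)
qed

text \<open>The real part of the equation gives \<open>x = t tan t\<close>, the imaginary part then
  gives \<open>exp x * (t / cos t) = y > 0\<close>, so \<open>t\<close> and \<open>cos t\<close>
  have the same sign. If both were negative, \<open>w\<close> would lie on the wrong side of the
  curve bounding the principal range.\<close>

lemma lambert_equation_imaginary:
  assumes w: "w * exp w = \<i> * of_real y" and "w \<in> lambert_W0_range" and y: "y > 0"
  shows "0 < Im w" "Im w < pi / 2" "Re w = Im w * tan (Im w)" "lambert_curve (Im w) = y"
proof -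
  define x t where "x = Re w" and "t = Im w"
  have r: "\<bar>t\<bar> < pi" "t < 0 \<Longrightarrow> x > - t * cot t"
    using assms(2) by (auto simp: lambert_W0_range_def x_def t_def)
  have "exp x * (x * cos t - t * sin t) = 0"
    using arg_cong[OF w, of Re] by (simp add: Re_exp Im_exp x_def t_def algebra_simps)
  then have re: "x * cos t = t * sin t" by simp
  have im: "exp x * (x * sin t + t * cos t) = y"
    using arg_cong[OF w, of Im] by (simp add: Re_exp Im_exp x_def t_def algebra_simps)
  have t0: "t \<noteq> 0" using re im y by auto
  have c0: "cos t \<noteq> 0"
  proof
    assume "cos t = 0"
    then have "sin t = 0" using re t0 by simp
    then show False using \<open>cos t = 0\<close> sin_cos_squared_add[of t] by simp
  qed
  have x: "x = t * tan t" using re c0 by (simp add: tan_def field_simps)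
  have "x * sin t + t * cos t = t / cos t"
    unfolding x by (rule tan_sin_plus_cos[OF c0])
  with im have y': "exp x * (t / cos t) = y" by simp
  have q: "t / cos t > 0" using y' y by (metis exp_gt_zero zero_less_mult_pos)
  have tpos: "t > 0"
  proof (rule ccontr)
    assume "\<not> t > 0"
    then have tneg: "t < 0" using t0 by simp
    then have "cos t < 0" using q by (simp add: zero_less_divide_iff)
    moreover have "sin t < 0" using sin_gt_zero[of "- t"] tneg r by simp
    ultimately have "tan t > 0" "cot t > 0" by (auto simp: tan_def cot_def divide_neg_neg)
    then have "t * tan t < 0" "- t * cot t > 0" using tneg by (auto simp: mult_neg_pos)
    then show False using r(2)[OF tneg] x by linarith
  qed
  then have "cos t > 0" using q by (simp add: zero_less_divide_iff)
  then have "t < pi / 2" using cos_lt_zero_pi[of t] r tpos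
    by (smt (verit) cos_monotone_0_pi_le cos_pi_half pi_half_gt_zero)
  then show "0 < Im w" "Im w < pi / 2" "Re w = Im w * tan (Im w)" "lambert_curve (Im w) = y"
    using tpos x y' by (auto simp: x_def t_def lambert_curve_def)
qed

text \<open>The point lies in the range because for \<open>0 < \<theta> < pi / 2\<close> the
  bounding curve has negative real part. Uniqueness follows from the strict monotonicity of
  \<open>lambert_curve\<close>.\<close>

lemma lambert_W0_imaginary:
  assumes \<theta>: "0 < \<theta>" "\<theta> < pi / 2"
  shows "lambert_W0 (\<i> * of_real (lambert_curve \<theta>)) = Complex (\<theta> * tan \<theta>) \<theta>"
  unfolding lambert_W0_def
proof (rule the_equality)
  have c: "cos \<theta> > 0" using \<theta> by (intro cos_gt_zero_pi) auto
  have t: "tan \<theta> > 0" using \<theta> by (intro tan_gt_zero)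
  have s: "sin \<theta> > 0" using \<theta> by (intro sin_gt_zero) auto
  let ?w = "Complex (\<theta> * tan \<theta>) \<theta>"
  have eq: "\<theta> * tan \<theta> * sin \<theta> + \<theta> * cos \<theta> = \<theta> / cos \<theta>"
    using c by (intro tan_sin_plus_cos) simp
  have "Re (?w * exp ?w) = 0"
    using c by (simp add: Re_exp Im_exp tan_def)
  moreover have "Im (?w * exp ?w) = lambert_curve \<theta>"
    unfolding lambert_curve_def eq[symmetric] by (simp add: Re_exp Im_exp algebra_simps)
  ultimately have "?w * exp ?w = \<i> * of_real (lambert_curve \<theta>)"
    by (simp add: complex_eq_iff)
  moreover have "- \<theta> * cot \<theta> \<le> \<theta> * tan \<theta>"
  proof -
    have "- \<theta> * cot \<theta> \<le> 0" using \<theta> c s by (simp add: cot_def)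
    also have "0 \<le> \<theta> * tan \<theta>" using \<theta> t by simp
    finally show ?thesis .
  qed
  then have "?w \<in> lambert_W0_range" using \<theta> by (simp add: lambert_W0_range_def)
  ultimately show "?w * exp ?w = \<i> * of_real (lambert_curve \<theta>) \<and> ?w \<in> lambert_W0_range" by blast
next
  fix w assume w: "w * exp w = \<i> * of_real (lambert_curve \<theta>) \<and> w \<in> lambert_W0_range"
  have c: "cos \<theta> > 0" using \<theta> by (intro cos_gt_zero_pi) auto
  have "lambert_curve \<theta> > 0" using \<theta> c by (simp add: lambert_curve_def)
  note * = lambert_equation_imaginary[OF conjunct1[OF w] conjunct2[OF w] this]
  have "Im w = \<theta>"
    using *(1,2,4) \<theta> lambert_curve_strict_mono[of "Im w" \<theta>] lambert_curve_strict_mono[of \<theta> "Im w"]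
    by (metis less_irrefl linorder_neqE_linordered_idom)
  then show "w = Complex (\<theta> * tan \<theta>) \<theta>" using *(3) by (simp add: complex_eq_iff)
qed

text \<open>Here \<open>cmod w = \<theta> / cos \<theta>\<close>, and \<open>Re (1 / w)\<close> is
  \<open>Re w\<close> divided by the square of this modulus. The result expresses the exponential
  factor of the claim through the angle alone.\<close>

lemma Ln_minus_inverse_lambert:
  assumes \<theta>: "0 < \<theta>" "\<theta> < pi / 2" and w: "w = Complex (\<theta> * tan \<theta>) \<theta>"
  shows "Re (Ln w - 1 / w) = ln (\<theta> / cos \<theta>) - sin \<theta> * cos \<theta> / \<theta>"
proof -
  have c: "cos \<theta> > 0" using \<theta> by (intro cos_gt_zero_pi) auto
  have n2: "(\<theta> * tan \<theta>)\<^sup>2 + \<theta>\<^sup>2 = (\<theta> / cos \<theta>)\<^sup>2"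
    using c by (intro tan_square_plus_square) simp
  then have n: "cmod w = \<theta> / cos \<theta>" using \<theta> c by (simp add: w cmod_def)
  have "Re (1 / w) = \<theta> * tan \<theta> / (\<theta> / cos \<theta>)\<^sup>2"
    by (simp add: Re_divide w n2)
  also have "\<dots> = sin \<theta> * cos \<theta> / \<theta>"
    unfolding tan_def using \<theta> c by (simp add: field_simps power2_eq_square)
  finally have "Re (1 / w) = sin \<theta> * cos \<theta> / \<theta>" .
  moreover have "w \<noteq> 0" using \<theta> by (simp add: w complex_eq_iff)
  ultimately show ?thesis by (simp add: n)
qed

subsection \<open>Height along the path\<close>

text \<open>Both summands have a nonnegative second derivative; for \<open>exp t / t\<close> the
  polynomial \<open>t^2 - 2 t + 2\<close> arises, which is a square plus 1.\<close>

lemma convex_on_exp_quadratic_over_id: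
  "convex_on {0<..} (\<lambda>t::real. t * exp t + b\<^sup>2 * (exp t / t))"
proof (rule f''_ge0_imp_convex)
  fix t :: real assume "t \<in> {0<..}"
  then have t: "t > 0" by simp
  show "((\<lambda>t. t * exp t + b\<^sup>2 * (exp t / t)) has_real_derivative
          (exp t * (t + 1) + b\<^sup>2 * (exp t * (1 / t - 1 / t\<^sup>2)))) (at t)"
    using t by (auto intro!: derivative_eq_intros simp: field_simps power2_eq_square)
  show "((\<lambda>t. exp t * (t + 1) + b\<^sup>2 * (exp t * (1 / t - 1 / t\<^sup>2))) has_real_derivative
          exp t * (t + 2) + b\<^sup>2 * (exp t * (((t - 1)\<^sup>2 + 1) / t ^ 3))) (at t)"
    using t by (auto intro!: derivative_eq_intros simp: field_simps power2_eq_square power3_eq_cube eval_nat_numeral)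
  show "0 \<le> exp t * (t + 2) + b\<^sup>2 * (exp t * (((t - 1)\<^sup>2 + 1) / t ^ 3))"
    using t by (intro add_nonneg_nonneg mult_nonneg_nonneg divide_nonneg_nonneg) auto
qed simp

text \<open>The sign of the derivative at \<open>t > 0\<close> is that of \<open>\<alpha> / c - (t * exp t + b\<^sup>2 * exp t / t)\<close>, and the
  bracket is convex; so left of the critical point \<open>x\<close> the function cannot first increase and then
  decrease.\<close>
lemma ray_exponent_le_max:
  fixes \<alpha> b c x t :: real
  assumes b: "b > 0" and c: "c > 0" and \<alpha>: "\<alpha> > 0" and x: "b \<le> x"
    and crit: "\<alpha> * x / (x\<^sup>2 + b\<^sup>2) = c * exp x" and t: "t \<ge> 0"
  defines "r \<equiv> (\<lambda>t. \<alpha> / 2 * ln (t\<^sup>2 + b\<^sup>2) - c * exp t)"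
  shows "r t \<le> max (r 0) (r x)"
proof -
  define D where "D = (\<lambda>t. \<alpha> * t / (t\<^sup>2 + b\<^sup>2) - c * exp t)"
  define P where "P = (\<lambda>t::real. t * exp t + b\<^sup>2 * (exp t / t))"
  have pos: "t\<^sup>2 + b\<^sup>2 > 0" for t using b by (simp add: add_nonneg_pos)
  have dr: "(r has_real_derivative D t) (at t)" for t
  proof -
    have "((\<lambda>t. ln (t\<^sup>2 + b\<^sup>2)) has_real_derivative 1 / (t\<^sup>2 + b\<^sup>2) * (2 * t)) (at t)"
      using pos[of t] by (auto intro!: derivative_eq_intros)
    then have "(r has_real_derivative \<alpha> / 2 * (1 / (t\<^sup>2 + b\<^sup>2) * (2 * t)) - c * exp t) (at t)"
      unfolding r_def by (intro DERIV_diff DERIV_cmult DERIV_exp)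
    then show ?thesis by (simp add: D_def)
  qed
  have sgn: "0 < D t \<longleftrightarrow> c * P t < \<alpha>" "D t < 0 \<longleftrightarrow> \<alpha> < c * P t" if "t > 0" for t
  proof -
    have "t * (t\<^sup>2 + b\<^sup>2)\<noteq> 0" using that pos[of t] by simp
    then have "D t = t / (t\<^sup>2 + b\<^sup>2) * (\<alpha> - c * P t)"
      unfolding D_def P_def using that pos[of t] by (simp add: field_simps power2_eq_square)
    moreover have "t / (t\<^sup>2 + b\<^sup>2) > 0" using that pos[of t] by simp
    ultimately obtain k where "k > 0" "D t = k * (\<alpha> - c * P t)" by blast
    then show "0 < D t \<longleftrightarrow> c * P t < \<alpha>" "D t < 0 \<longleftrightarrow> \<alpha> < c * P t"
      by (simp_all add: zero_less_mult_iff mult_less_0_iff)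
  qed
  have x0: "x > 0" using b x by simp
  have "D x = 0" using crit by (simp add: D_def)
  then have Px: "c * P x = \<alpha>" using sgn[OF x0] by linarith
  show ?thesis
  proof (cases "x \<le> t")
    case True
    have "r t \<le> r x"
    proof (rule DERIV_nonpos_imp_nonincreasing[OF True])
      fix s assume s: "x \<le> s" "s \<le> t"
      \<comment> \<open>Beyond \<open>b\<close> the function \<open>s / (s^2 + b^2)\<close>
        decreases, while \<open>c * exp s\<close> increases. So the derivative, zero at
        \<open>x\<close>, stays nonpositive to the right.\<close>
      have "b * b \<le> s * x" using b x s by (intro mult_mono) auto
      then have "(s - x) * (b * b - s * x) \<le> 0" using s by (intro mult_nonneg_nonpos) auto
      then have "s / (s\<^sup>2 + b\<^sup>2) \<le> x / (x\<^sup>2 + b\<^sup>2)"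
        using pos[of s] pos[of x] by (simp add: divide_simps algebra_simps power2_eq_square)
      then have "\<alpha> * (s / (s\<^sup>2 + b\<^sup>2)) \<le> \<alpha> * (x / (x\<^sup>2 + b\<^sup>2))" using \<alpha> by (intro mult_left_mono) auto
      moreover have "c * exp x \<le> c * exp s" using s c by simp
      ultimately have "D s \<le> 0" using crit by (simp add: D_def)
      then show "\<exists>y. (r has_real_derivative y) (at s) \<and> y \<le> 0" using dr by blast
    qed
    then show ?thesis by simp
  next
    case False
    show ?thesis
    proof (rule ccontr)
      assume "\<not> ?thesis"
      then have gt: "r t > r 0" "r t > r x" by auto
      then have t0: "t > 0" using t by (cases "t = 0") auto
      \<comment> \<open>An interior value above both ends would give a rise at some
        \<open>s1 < t\<close> and a fall at some \<open>s2\<close> between \<open>t\<close> and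
        \<open>x\<close>. Then \<open>P s2\<close> exceeds both \<open>P s1\<close> and
        \<open>P x\<close>, against convexity.\<close>
      obtain s1 where s1: "0 < s1" "s1 < t" "r t - r 0 = (t - 0) * D s1"
        using MVT2[of 0 t r D] t0 dr by blast
      obtain s2 where s2: "t < s2" "s2 < x" "r x - r t = (x - t) * D s2"
        using MVT2[of t x r D] False dr by force
      have "0 < (t - 0) * D s1" using s1(3) gt(1) by linarith
      then have "D s1 > 0" using t0 by (simp add: zero_less_mult_iff)
      then have P1: "c * P s1 < \<alpha>" using sgn(1)[of s1] s1 by simp
      have "(x - t) * D s2 < 0" using s2 gt by linarith
      then have "D s2 < 0" using False by (simp add: mult_less_0_iff)
      then have P2: "\<alpha> < c * P s2" using sgn(2)[of s2] s2 t0 by simp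
      have "convex_on {s1..x} P"
        unfolding P_def using s1
        by (intro convex_on_subset[OF convex_on_exp_quadratic_over_id]) auto
      then have "P s2 \<le> max (P s1) (P x)"
        using s1 s2 by (intro convex_on_le_max) auto
      then have "c * P s2 \<le> max (c * P s1) (c * P x)"
        using c by (auto simp: le_max_iff_disj)
      then show False using P1 P2 Px by simp
    qed
  qed
qed

lemma norm_Complex_powr_times_exp:
  assumes "b > 0"
  shows "norm (Complex t b) powr \<alpha> * exp (- y) = exp (\<alpha> / 2 * ln (t\<^sup>2 + b\<^sup>2) - y)"
proof -
  have "t\<^sup>2 + b\<^sup>2 > 0" using assms by (simp add: add_nonneg_pos)
  then have "norm (Complex t b) powr \<alpha> = exp (\<alpha> * (ln (t\<^sup>2 + b\<^sup>2) / 2))"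
    using assms by (simp add: powr_def cmod_def ln_sqrt)
  then show ?thesis
    by (simp add: exp_add[symmetric])
qed

section \<open>Explicit bounds for small and large angles\<close>

lemma cos_le_exp_half:
  assumes "1 \<le> x" "x < pi / 2"
  shows "cos x \<le> exp (- 1 / 2)"
proof -
  have x: "0 \<le> x" using assms by simp
  \<comment> \<open>The derivative has the sign of \<open>t cos t - sin t\<close>, which is
    nonpositive by \<open>t \<le> tan t\<close>; hence
    \<open>cos x \<le> exp (- x^2 / 2)\<close>.\<close>
  have "cos x * exp (x\<^sup>2 / 2) \<le> cos 0 * exp (0\<^sup>2 / 2)"
  proof (rule DERIV_nonpos_imp_nonincreasing[OF x])
    fix t assume t: "0 \<le> t" "t \<le> x"
    have "cos t > 0" using t assms by (intro cos_gt_zero_pi) auto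
    moreover have "t \<le> tan t" using abs_tan_ge[of t] t assms tan_pos_pi2_le[of t] by auto
    ultimately have "t * cos t \<le> sin t" by (simp add: tan_def pos_le_divide_eq)
    then have "(t * cos t - sin t) * exp (t\<^sup>2 / 2) \<le> 0" by (intro mult_nonpos_nonneg) auto
    moreover have "((\<lambda>t. cos t * exp (t\<^sup>2 / 2)) has_real_derivative (t * cos t - sin t) * exp (t\<^sup>2 / 2)) (at t)"
      by (auto intro!: derivative_eq_intros simp: algebra_simps)
    ultimately show "\<exists>y. ((\<lambda>t. cos t * exp (t\<^sup>2 / 2)) has_real_derivative y) (at t) \<and> y \<le> 0"
      by blast
  qed
  then have "cos x \<le> exp (- (x\<^sup>2 / 2))" by (simp add: exp_minus field_simps)
  also have "\<dots> \<le> exp (- 1 / 2)" using assms power_mono[of 1 x 2] by simp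
  finally show ?thesis .
qed

lemma stieltjes_C_bound_small_angle:
  assumes a: "0 < a" "a \<le> 1" and \<alpha>: "1 < \<alpha>" "\<alpha> \<le> 19"
  shows "\<bar>stieltjes_C \<alpha> a\<bar> \<le> 14"
proof -
  have s2: "1.4 \<le> sqrt 2" by (rule real_le_rsqrt) (simp add: power2_eq_square)
  have "sin (pi / 4) \<le> sin 1" using pi_approx by (intro sin_monotone_2pi_le) auto
  then have s1: "0.7 \<le> sin (1::real)" using s2 by (simp add: sin_45)
  have "3.1 * 0.7 \<le> pi * sin 1" using s1 pi_approx by (intro mult_mono) auto
  then have ps: "4.34 \<le> 2 * pi * sin 1" by simp
  \<comment> \<open>Height \<open>h = 1\<close>, left bound \<open>L = 1\<close>, and on the top
    edge the majorant \<open>exp (1 - t)\<close>, that is \<open>A = exp 1\<close> and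
    \<open>c = 1\<close>.\<close>
  have "\<bar>stieltjes_C \<alpha> a\<bar> \<le> 2 * 1 * 1 + 4 * exp 1 / 1"
  proof (rule abs_stieltjes_C_le[OF a \<alpha>(1)])
    show "t powr (\<alpha> - 1) \<le> 1" if "0 < t" "t \<le> 1" for t
      using that \<alpha> powr_le1[of "\<alpha> - 1" t] by simp
    fix t :: real assume t: "0 \<le> t"
    have "exp 0 - 0\<^sup>2 \<le> exp t - t\<^sup>2"
    proof (rule DERIV_nonneg_imp_nondecreasing[OF t])
      fix s :: real assume s: "0 \<le> s" "s \<le> t"
      have "0 \<le> (s - 1)\<^sup>2" by simp
      then have "2 * s \<le> exp s" using exp_lower_Taylor_quadratic[OF s(1)]
        by (simp add: power2_eq_square algebra_simps)
      moreover have "((\<lambda>t. exp t - t\<^sup>2) has_real_derivative exp s - 2 * s) (at s)"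
        by (auto intro!: derivative_eq_intros)
      ultimately show "\<exists>y. ((\<lambda>t. exp t - t\<^sup>2) has_real_derivative y) (at s) \<and> 0 \<le> y"
        by (intro exI[of _ "exp s - 2 * s"]) simp
    qed
    then have "t\<^sup>2 + 1\<^sup>2 \<le> exp t" by simp
    moreover have "t\<^sup>2 + 1\<^sup>2 > 0" by (simp add: add_nonneg_pos)
    ultimately have "ln (t\<^sup>2 + 1\<^sup>2) \<le> t" by (metis ln_exp ln_le_cancel_iff exp_gt_zero)
    then have "\<alpha> / 2 * ln (t\<^sup>2 + 1\<^sup>2) \<le> 19 / 2 * t"
      using \<alpha> t by (intro mult_mono) auto
    moreover have "4.34 * (1 + t + t\<^sup>2 / 2) \<le> 2 * pi * sin 1 * exp t"
      using ps exp_lower_Taylor_quadratic[OF t] t by (intro mult_mono) auto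
    \<comment> \<open>The difference of the two sides is \<open>2.17 t^2 - 6.16 t + 5.34\<close>,
      whose vertex is at \<open>6.16 / 4.34\<close> and whose minimum is positive. Here 4.34 comes
      from \<open>2 * 3.1 * 0.7\<close>.\<close>
    moreover have "19 / 2 * t - 4.34 * (1 + t + t\<^sup>2 / 2) \<le> 1 - t"
    proof -
      have "0 \<le> 2.17 * (t - 6.16 / 4.34)\<^sup>2" by simp
      then show ?thesis by (simp add: power2_eq_square field_simps)
    qed
    moreover have "2 * pi * exp t * sin 1 = 2 * pi * sin 1 * exp t" by simp
    ultimately have "\<alpha> / 2 * ln (t\<^sup>2 + 1\<^sup>2) - 2 * pi * exp t * sin 1 \<le> 1 - t"
      by linarith
    then have "exp (\<alpha> / 2 * ln (t\<^sup>2 + 1\<^sup>2) - 2 * pi * exp t * sin 1) \<le> exp (1 - t)" by simp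
    then show "norm (Complex t 1) powr \<alpha> * exp (- 2 * pi * exp t * sin 1) \<le> exp 1 * exp (- 1 * t)"
      using norm_Complex_powr_times_exp[of 1 t \<alpha> "2 * pi * exp t * sin 1"]
      by (simp add: exp_add[symmetric])
  qed (use pi_approx ps in auto)
  also have "\<dots> \<le> 14" using exp_le by simp
  finally show ?thesis .
qed

lemma cos_45_inverse: "cos (pi / 4) = 1 / sqrt 2"
proof -
  have "cos (pi / 4) * sqrt 2 = 1" by (simp add: cos_45)
  then show ?thesis by (simp add: nonzero_eq_divide_eq)
qed

text \<open>Each factor is estimated by its size at \<open>pi / 4\<close>; the product stays below
  17, within the range that \<open>stieltjes_C_bound_small_angle\<close> covers.\<close>

lemma lambert_curve_small_angle:
  assumes "0 < \<theta>" "\<theta> \<le> pi / 4"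
  shows "2 * pi * lambert_curve \<theta> \<le> 19"
proof -
  have "1 / sqrt 2 \<le> cos \<theta>"
    unfolding cos_45_inverse[symmetric] using assms by (intro cos_monotone_0_pi_le) auto
  then have "\<theta> / cos \<theta> \<le> (pi / 4) / (1 / sqrt 2)"
    using assms by (intro frac_le) auto
  also have "\<dots> = pi / 4 * sqrt 2" by simp
  also have "\<dots> \<le> 0.7854 * 1.42"
    using pi_approx by (intro mult_mono real_le_lsqrt) (auto simp: power2_eq_square)
  finally have 1: "\<theta> / cos \<theta> \<le> 0.7854 * 1.42" .
  have "tan \<theta> \<le> 1"
    using tan_mono_le[of \<theta> "pi / 4"] assms by (simp add: tan_45)
  then have "\<theta> * tan \<theta> \<le> 0.7854 * 1"
    using assms pi_approx tan_pos_pi2_le[of \<theta>] by (intro mult_mono) auto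
  then have "exp (\<theta> * tan \<theta>) \<le> exp 0.7854" by simp
  also have "\<dots> \<le> 1 + 0.7854 + 0.7854\<^sup>2" by (rule exp_bound) auto
  finally have 2: "exp (\<theta> * tan \<theta>) \<le> 2.41" by (simp add: power2_eq_square)
  have "cos \<theta> > 0" using assms by (intro cos_gt_zero_pi) auto
  then have "lambert_curve \<theta> \<le> 2.41 * (0.7854 * 1.42)"
    unfolding lambert_curve_def using 1 2 assms by (intro mult_mono) auto
  then have "2 * pi * lambert_curve \<theta> \<le> 2 * 3.1416 * (2.41 * (0.7854 * 1.42))"
    using pi_approx \<open>cos \<theta> > 0\<close> assms by (intro mult_mono) (auto simp: lambert_curve_def)
  then show ?thesis by simp
qed

text \<open>Two consequences of \<open>tan \<theta> \<ge> 1\<close> and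
  \<open>cos \<theta> \<le> 1 / sqrt 2\<close>. The value 12.5 is large enough for
  \<open>4 + 12 \<alpha> < \<alpha>^2\<close> in the end, and the second claim,
  \<open>Im w \<le> Re w\<close>, is the condition \<open>b \<le> x\<close> of
  \<open>ray_exponent_le_max\<close>.\<close>

lemma lambert_curve_large_angle:
  assumes "pi / 4 \<le> \<theta>" "\<theta> < pi / 2"
  shows "12.5 \<le> 2 * pi * lambert_curve \<theta>" "\<theta> \<le> \<theta> * tan \<theta>"
proof -
  have c: "cos \<theta> > 0" using assms by (intro cos_gt_zero_pi) auto
  have "1 \<le> tan \<theta>"
    using tan_mono_le[of "pi / 4" \<theta>] assms by (simp add: tan_45)
  then show x: "\<theta> \<le> \<theta> * tan \<theta>" using assms pi_gt_zero
    by (metis less_imp_le mult.right_neutral mult_left_mono divide_pos_pos less_le_trans zero_less_numeral)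
  have 0: "0.785 \<le> \<theta>" using assms pi_approx by simp
  have "1 + 0.785 + 0.785\<^sup>2 / 2 \<le> exp (0.785::real)" by (rule exp_lower_Taylor_quadratic) simp
  also have "\<dots> \<le> exp (\<theta> * tan \<theta>)"
    unfolding exp_le_cancel_iff using 0 x by (rule order_trans)
  finally have 1: "2.09 \<le> exp (\<theta> * tan \<theta>)" by (simp add: power2_eq_square)
  have "cos \<theta> \<le> 1 / 1.4"
  proof -
    have "cos \<theta> \<le> cos (pi / 4)" using assms by (intro cos_monotone_0_pi_le) auto
    also have "\<dots> = 1 / sqrt 2" by (rule cos_45_inverse)
    also have "\<dots> \<le> 1 / 1.4"
      by (intro divide_left_mono real_le_rsqrt) (auto simp: power2_eq_square)
    finally show ?thesis .
  qed
  then have "0.785 / (1 / 1.4) \<le> \<theta> / cos \<theta>" using 0 c by (intro frac_le) auto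
  then have "2.09 * (0.785 / (1 / 1.4)) \<le> lambert_curve \<theta>"
    unfolding lambert_curve_def using 1 by (intro mult_mono) auto
  then have "2 * 3.1 * (2.09 * (0.785 / (1 / 1.4))) \<le> 2 * pi * lambert_curve \<theta>"
    using pi_approx by (intro mult_mono) auto
  then show "12.5 \<le> 2 * pi * lambert_curve \<theta>" by simp
qed

lemma stieltjes_C_bound_large_angle:
  assumes a: "0 < a" "a \<le> 1" and \<theta>: "pi / 4 \<le> \<theta>" "\<theta> < pi / 2"
    and \<alpha>: "\<alpha> = 2 * pi * lambert_curve \<theta>"
    and M: "M = exp (\<alpha> * (ln (\<theta> / cos \<theta>) - sin \<theta> * cos \<theta> / \<theta>))"
  shows "\<bar>stieltjes_C \<alpha> a\<bar> \<le> (4 + 12 * \<alpha>) * max 1 M"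
proof -
  define x where "x = \<theta> * tan \<theta>"
  define c where "c = 2 * pi * sin \<theta>"
  define B where "B = max 1 M"
  have \<theta>0: "\<theta> > 0" using \<theta> pi_gt_zero by linarith
  have cos: "cos \<theta> > 0" using \<theta> \<theta>0 by (intro cos_gt_zero_pi) auto
  have x\<theta>: "\<theta> \<le> x" unfolding x_def by (rule lambert_curve_large_angle[OF \<theta>])
  have \<alpha>12: "12.5 \<le> \<alpha>" unfolding \<alpha> by (rule lambert_curve_large_angle[OF \<theta>])
  have s: "1 / 2 \<le> sin \<theta>"
    using sin_monotone_2pi_le[of "pi / 6" \<theta>] \<theta> by (simp add: sin_30)
  then have c2: "2 \<le> c"
    unfolding c_def using pi_approx mult_mono[of 4 "2 * pi" "1 / 2" "sin \<theta>"] by simp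
  have n2: "x\<^sup>2 + \<theta>\<^sup>2 = (\<theta> / cos \<theta>)\<^sup>2"
    unfolding x_def using cos by (intro tan_square_plus_square) simp
  have cx: "c * exp x = \<alpha> * (sin \<theta> * cos \<theta> / \<theta>)"
    unfolding c_def \<alpha> lambert_curve_def x_def using cos \<theta>0 by simp
  \<comment> \<open>Both sides of the critical equation equal \<open>\<alpha> * Re (1 / w)\<close>,
    so \<open>x = Re w\<close> is a critical point of \<open>r\<close>. The same quantity is
    subtracted in the exponent of \<open>M\<close>.\<close>
  have "\<alpha> * x / (x\<^sup>2 + \<theta>\<^sup>2) = \<alpha> * (sin \<theta> * cos \<theta> / \<theta>)"
    unfolding n2 unfolding x_def tan_def using cos \<theta>0 by (simp add: field_simps power2_eq_square)
  then have crit: "\<alpha> * x / (x\<^sup>2 + \<theta>\<^sup>2) = c * exp x" using cx by simp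
  define r where "r = (\<lambda>t. \<alpha> / 2 * ln (t\<^sup>2 + \<theta>\<^sup>2) - c * exp t)"
  have rx: "exp (r x) = M"
  proof -
    have "ln ((\<theta> / cos \<theta>)\<^sup>2) = 2 * ln (\<theta> / cos \<theta>)"
      using cos \<theta>0 by (subst ln_realpow) auto
    then show ?thesis unfolding r_def M n2 cx by (simp add: algebra_simps)
  qed
  \<comment> \<open>This controls the left edge and the start \<open>t = 0\<close> of the top edge.
    For \<open>\<theta> > 1\<close> the gain \<open>- ln (cos \<theta>) \<ge> 1 / 2\<close> pays for
    the subtracted \<open>sin \<theta> * cos \<theta> / \<theta> \<le> 1 / 2\<close>.\<close>
  have pM: "\<theta> powr \<alpha> \<le> B"
  proof (cases "\<theta> \<le> 1")
    case True
    then have "\<theta> powr \<alpha> \<le> 1" using \<theta>0 \<alpha>12 by (intro powr_le1) auto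
    then show ?thesis by (simp add: B_def)
  next
    case False
    have "ln (cos \<theta>) \<le> ln (exp (- 1 / 2))"
      using cos cos_le_exp_half[of \<theta>] \<theta> False by (subst ln_le_cancel_iff) auto
    then have "ln (cos \<theta>) \<le> - 1 / 2" by (simp only: ln_exp)
    moreover have "sin \<theta> * cos \<theta> / \<theta> \<le> 1 / 2"
    proof -
      have "2 * (sin \<theta> * cos \<theta>) \<le> 1" using sin_le_one[of "2 * \<theta>"] by (simp add: sin_double)
      then show ?thesis using False by (simp add: divide_simps)
    qed
    moreover have "ln (\<theta> / cos \<theta>) = ln \<theta> - ln (cos \<theta>)"
      using cos \<theta>0 by (simp add: ln_div)
    ultimately have "ln \<theta> \<le> ln (\<theta> / cos \<theta>) - sin \<theta> * cos \<theta> / \<theta>"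
      by linarith
    then have "\<theta> powr \<alpha> \<le> M"
      unfolding M powr_def using \<theta>0 \<alpha>12 by (simp add: mult_left_mono)
    then show ?thesis by (simp add: B_def)
  qed
  have r0: "exp (r 0) \<le> \<theta> powr \<alpha>"
    using c2 \<theta>0 unfolding r_def powr_def by (simp add: ln_realpow)
  have rB: "exp (r t) \<le> B" if "t \<ge> 0" for t
  proof -
    have "r t \<le> max (r 0) (r x)"
      unfolding r_def using \<theta>0 c2 \<alpha>12 x\<theta> crit that by (intro ray_exponent_le_max) auto
    then have "exp (r t) \<le> max (exp (r 0)) (exp (r x))" by (auto simp: le_max_iff_disj)
    also have "\<dots> \<le> B" using r0 pM rx by (auto simp: B_def)
    finally show ?thesis .
  qed
  \<comment> \<open>Past \<open>\<alpha>\<close> the logarithmic term is at most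
    \<open>\<alpha> t \<le> t^2\<close>, whereas \<open>c * exp t\<close> is at least
    \<open>2 + 2 t + t^2\<close>.\<close>
  have rt: "r t \<le> - t" if t: "\<alpha> \<le> t" for t
  proof -
    have t1: "t \<ge> 12.5" using t \<alpha>12 by simp
    have q: "1 + t + t\<^sup>2 / 2 \<le> exp t" using t1 by (intro exp_lower_Taylor_quadratic) simp
    have "\<theta>\<^sup>2 \<le> 2\<^sup>2" using \<theta> \<theta>0 pi_approx by (intro power_mono) auto
    then have "t\<^sup>2 + \<theta>\<^sup>2 \<le> 2 * (1 + t + t\<^sup>2 / 2)"
      using t1 by (simp add: algebra_simps)
    also have "\<dots> \<le> 2 * exp t" using q by (intro mult_left_mono) auto
    also have "\<dots> \<le> exp t * exp t"
    proof (rule mult_right_mono)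
      show "2 \<le> exp t" using exp_ge_add_one_self[of t] t1 by linarith
    qed simp
    finally have "t\<^sup>2 + \<theta>\<^sup>2 \<le> exp (2 * t)" by (simp add: exp_add[symmetric])
    moreover have "t\<^sup>2 + \<theta>\<^sup>2 > 0" using \<theta>0 by (simp add: add_nonneg_pos)
    ultimately have "ln (t\<^sup>2 + \<theta>\<^sup>2) \<le> 2 * t" by (metis ln_exp ln_le_cancel_iff exp_gt_zero)
    then have "\<alpha> / 2 * ln (t\<^sup>2 + \<theta>\<^sup>2) \<le> \<alpha> / 2 * (2 * t)" using \<alpha>12 by (intro mult_left_mono) auto
    also have "\<dots> \<le> t\<^sup>2" using t t1 by (simp add: power2_eq_square mult_right_mono)
    finally have "\<alpha> / 2 * ln (t\<^sup>2 + \<theta>\<^sup>2) \<le> t\<^sup>2" .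
    moreover have "2 * exp t \<le> c * exp t" using c2 by (intro mult_right_mono) auto
    ultimately show ?thesis unfolding r_def using q t1 by linarith
  qed
  \<comment> \<open>The uniform bound \<open>B\<close> is converted into an integrable majorant of
    rate \<open>1 / \<alpha>\<close>: up to \<open>t = \<alpha>\<close> this costs at most the
    factor \<open>exp 1\<close>, and afterwards the decay of \<open>r\<close> takes over. The
    integral thus contributes a multiple of \<open>\<alpha> * B\<close>.\<close>
  have top: "exp (r t) \<le> B * exp 1 * exp (- (1 / \<alpha>) * t)" if t: "t \<ge> 0" for t
  proof (cases "t \<le> \<alpha>")
    case True
    have "1 \<le> exp (1 - t / \<alpha>)" using True \<alpha>12 by simp
    then have "B * 1 \<le> B * exp (1 - t / \<alpha>)" by (intro mult_left_mono) (auto simp: B_def)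
    then show ?thesis using rB[OF t] by (simp add: exp_add[symmetric] mult.assoc)
  next
    case False
    have "t * 1 \<le> t * \<alpha>" using t \<alpha>12 by (intro mult_left_mono) auto
    then have "t / \<alpha> \<le> t" using \<alpha>12 by (simp add: divide_simps)
    then have "r t \<le> 1 - t / \<alpha>" using rt[of t] False by simp
    then have "exp (r t) \<le> 1 * exp (1 - t / \<alpha>)" by simp
    also have "\<dots> \<le> B * exp (1 - t / \<alpha>)" by (intro mult_right_mono) (auto simp: B_def)
    finally show ?thesis by (simp add: exp_add[symmetric] mult.assoc)
  qed
  have "\<bar>stieltjes_C \<alpha> a\<bar> \<le> 2 * \<theta> * B + 4 * (B * exp 1) / (1 / \<alpha>)"
  proof (rule abs_stieltjes_C_le[OF a])
    show "t powr (\<alpha> - 1) \<le> B" if t: "0 < t" "t \<le> \<theta>" for t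
    proof (cases "t \<le> 1")
      case True
      then have "t powr (\<alpha> - 1) \<le> 1" using t \<alpha>12 by (intro powr_le1) auto
      then show ?thesis by (simp add: B_def)
    next
      case False
      then have "t powr (\<alpha> - 1) \<le> t powr \<alpha>" by (intro powr_mono) auto
      also have "\<dots> \<le> \<theta> powr \<alpha>" using t \<alpha>12 by (intro powr_mono2) auto
      finally show ?thesis using pM by simp
    qed
    fix t :: real assume "0 \<le> t"
    then show "norm (Complex t \<theta>) powr \<alpha> * exp (- 2 * pi * exp t * sin \<theta>) \<le> B * exp 1 * exp (- (1 / \<alpha>) * t)"
      using top norm_Complex_powr_times_exp[OF \<theta>0, of t \<alpha> "2 * pi * exp t * sin \<theta>"]
      by (simp add: r_def c_def mult_ac)
  qed (use \<alpha>12 \<theta> \<theta>0 c2 in \<open>auto simp: B_def c_def\<close>)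
  also have "\<dots> = 2 * \<theta> * B + 4 * \<alpha> * exp 1 * B" by simp
  also have "\<dots> \<le> 4 * B + 4 * \<alpha> * 3 * B"
    using \<theta> pi_approx \<alpha>12 exp_le by (intro add_mono mult_right_mono mult_left_mono) (auto simp: B_def)
  also have "\<dots> = (4 + 12 * \<alpha>) * B" by (simp add: algebra_simps)
  finally show ?thesis by (simp add: B_def)
qed

section \<open>Assembly of the two ranges of the angle\<close>

theorem theorem8:
  fixes \<alpha> a :: real and w :: complex
  assumes "\<alpha> \<ge> 2 * pi"
    and "a \<in> {0<..1}"
    and "w = lambert_W0 (of_real \<alpha> * \<i> / of_real (2 * pi))"
  shows "\<bar>stieltjes_C \<alpha> a\<bar>
           < \<alpha>\<^sup>2 + 3 / 4 * \<alpha>\<^sup>2 * ln \<alpha> * cmod (exp (of_real \<alpha> * (Ln w - 1 / w)))"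
proof -
  have a: "0 < a" "a \<le> 1" using assms(2) by auto
  have \<alpha>6: "\<alpha> \<ge> 6" using assms(1) pi_approx by simp
  obtain \<theta> where \<theta>: "0 < \<theta>" "\<theta> < pi / 2" "lambert_curve \<theta> = \<alpha> / (2 * pi)"
    using lambert_curve_surj[of "\<alpha> / (2 * pi)"] \<alpha>6 by auto
  have \<alpha>: "\<alpha> = 2 * pi * lambert_curve \<theta>" using \<theta>(3) by simp
  have "of_real \<alpha> * \<i> / of_real (2 * pi) = \<i> * of_real (lambert_curve \<theta>)"
    using \<theta>(3) by simp
  then have w: "w = Complex (\<theta> * tan \<theta>) \<theta>"
    using assms(3) lambert_W0_imaginary[OF \<theta>(1,2)] by simp
  define M where "M = exp (\<alpha> * (ln (\<theta> / cos \<theta>) - sin \<theta> * cos \<theta> / \<theta>))"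
  have M: "cmod (exp (of_real \<alpha> * (Ln w - 1 / w))) = M"
    unfolding norm_exp_eq_Re M_def Ln_minus_inverse_lambert[OF \<theta>(1,2) w, symmetric] by simp
  have M0: "M > 0" by (simp add: M_def)
  have "6 * 6 \<le> \<alpha> * \<alpha>" using \<alpha>6 by (intro mult_mono) auto
  then have \<alpha>36: "36 \<le> \<alpha>\<^sup>2" by (simp add: power2_eq_square)
  show ?thesis
  proof (cases "\<theta> \<le> pi / 4")
    case True
    then have "\<alpha> \<le> 19" unfolding \<alpha> by (intro lambert_curve_small_angle \<theta>)
    then have "\<bar>stieltjes_C \<alpha> a\<bar> \<le> 14"
      using \<alpha>6 by (intro stieltjes_C_bound_small_angle a) auto
    also have "14 < \<alpha>\<^sup>2" using \<alpha>36 by simp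
    also have "\<dots> \<le> \<alpha>\<^sup>2 + 3 / 4 * \<alpha>\<^sup>2 * ln \<alpha> * cmod (exp (of_real \<alpha> * (Ln w - 1 / w)))"
      using \<alpha>6 by simp
    finally show ?thesis .
  next
    case False
    then have \<theta>4: "pi / 4 \<le> \<theta>" by simp
    have \<alpha>12: "12.5 \<le> \<alpha>" unfolding \<alpha> by (rule lambert_curve_large_angle[OF \<theta>4 \<theta>(2)])
    have "12.5 * \<alpha> \<le> \<alpha>\<^sup>2"
      unfolding power2_eq_square using \<alpha>12 by (intro mult_right_mono) auto
    then have lt: "4 + 12 * \<alpha> < \<alpha>\<^sup>2" using \<alpha>12 by linarith
    have "exp 2 \<le> \<alpha>"
    proof -
      have "exp 2 = exp 1 * exp (1::real)" by (simp add: exp_add[symmetric])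
      also have "\<dots> \<le> 3 * 3" using exp_le by (intro mult_mono) auto
      finally show ?thesis using \<alpha>12 by simp
    qed
    then have ln: "2 \<le> ln \<alpha>" using \<alpha>12 by (simp add: ln_ge_iff)
    have "\<bar>stieltjes_C \<alpha> a\<bar> \<le> (4 + 12 * \<alpha>) * max 1 M"
      by (rule stieltjes_C_bound_large_angle[OF a \<theta>4 \<theta>(2) \<alpha> M_def])
    \<comment> \<open>Replacing the maximum by \<open>1 + M\<close> produces the two terms of the
      claim; the second has room to spare because \<open>ln \<alpha> \<ge> 2\<close> makes
      \<open>3 / 4 * ln \<alpha>\<close> exceed 1.\<close>
    also have "\<dots> \<le> (4 + 12 * \<alpha>) * (1 + M)" using \<alpha>12 M0 by (intro mult_left_mono) auto
    also have "\<dots> < \<alpha>\<^sup>2 * (1 + M)" using lt M0 by (intro mult_strict_right_mono) auto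
    also have "\<dots> = \<alpha>\<^sup>2 + \<alpha>\<^sup>2 * M" by (simp add: algebra_simps)
    also have "\<alpha>\<^sup>2 * M = \<alpha>\<^sup>2 * 1 * M" by simp
    also have "\<dots> \<le> \<alpha>\<^sup>2 * (3 / 4 * ln \<alpha>) * M"
      using ln M0 by (intro mult_right_mono mult_left_mono) auto
    finally show ?thesis unfolding M by (simp add: mult_ac)
  qed
qed

end
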